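(* Let $c\in(0.5,2)\setminus\{1\}$, and let $\mathcal{A}_c\subset\Delta_c$ be the renormalization attractor (the set of all points $(a,v)_{(r_i)_{i\in\mathbb{Z}}}$ defined in the context). Then there exist a $D\mathcal{T}_c$-invariant splitting $E^u_z\oplus E^s_z$ of the tangent spaces $T_z\Delta_c\cong\mathbb{R}^2$, $z\in\mathcal{A}_c$, a number $k_0\in\mathbb{N}$ and a constant $\lambda>1$ such that for every $z\in\mathcal{A}_c$ $$\|D\mathcal{T}_c^{k_0}w\|>\lambda\|w\|\ \text{ for all nonzero } w\in E^u_z,\qquad \|D\mathcal{T}_c^{k_0}w\|<\lambda^{-1}\|w\|\ \text{ for all nonzero } w\in E^s_z,$$ where the derivative is taken at $z$.
   Context: Fix a real $c>0$, $c\ne1$; $\mathbb{N}=\{1,2,\dots\}$. Let $\mathcal{D}_c=\{(a,v)\in\mathbb{R}^2: 0<a\le c,\ a+v>c-1\}$. For $(a,v)\in\mathcal{D}_c$ put $$F=F_{a,v,c}(x)=\frac{a+cx}{1-vx},\qquad G=G_{a,v,c}(x)=\frac{a(x-c)}{ac+x(1+v-c)},\qquad b=\frac{c-a}{v+1}\in[0,1).$$ $F:[-1,0]\to[-b,a]$ and $G:[0,a]\to[-1,-b]$ are increasing homeomorphisms with $F(0)=a$, $G(0)=-1$, $F(-1)=G(a)=-b$. Write $\zeta_{a,v,c}=(F,G)$. Height and renormalization. The height of $\zeta_{a,v,c}$ is the smallest $r\in\mathbb{N}$ with $F^{r}(-1)\le0<F^{r+1}(-1)$, and $r=\infty$ if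 there is none. If $r<\infty$, the renormalization of the pair is $(\alpha\circ F^{r}\circ G\circ\alpha^{-1},\ \alpha\circ F\circ\alpha^{-1})$ with $\alpha(x)=-x/a$, on $[-1,0]$ and $[0,a']$ respectively. It is a known fact that this is the pair $\zeta_{a',v',1/c}$ with $a'=-F^{r}(-1)/a$, $b'=F^{r+1}(-1)/a$, $v'=(1/c-a'-b')/b'$. Define $\mathcal{R}_c(a,v)=(a',v')$; it lies in $\mathcal{D}_{1/c}$ unless $F^r(-1)=0$, in which case $a'=0$, the pair is not renormalizable further and the next height is $\infty$. $\mathcal{O}^n_c\subset\mathcal{D}_c$ is the set of $(a,v)$ that are $n$ times renormalizable (the parameter $c$ alternating between $c$ and $1/c$), and $\mathcal{O}^\infty_c=\bigcap_n\mathcal{O}^n_c$. If $r_0,r_1,\dots$ are the heights of $\zeta_{a,v,c}$ and its successive renormalizations (stopping at the first $\infty$), the rotation number is $\rho(\zeta_{a,v,c})=[r_0,r_1,\dots]=1/(r_0+1/(r_1+\cdots))$, with $1/\infty=0$; it is irrational iff $(a,v)\in\mathcal{O}^\infty_c$. The map $\mathcal{R}_c$ is known to be injective. Set $\mathcal{T}_c=\mathcal{R}_{1/c}\circ\mathcal{R}_c:\mathcal{O}^2_c\to\mathcal{D}_c$; it is analytic near every point of $\mathcal{O}^\infty_c$, since heights are locally constant there. $\Delta_c=\{(a,v)\in\mathcal{D}_c: 0\le v\le c-1\}$ if $c>1$, and $\Delta_c=\{(a,v)\in\mathcal{D}_c: c-1\le v\le0\}$ if $c<1$. The set $\mathcal{A}_c$.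 For $c\in(0.5,2)\setminus\{1\}$ and each bi-infinite sequence $(r_i)_{i\in\mathbb{Z}}$ in $\mathbb{N}$, there is a unique point $(a,v)=(a,v)_{(r_i)_{i\in\mathbb{Z}}}\in\Delta_c$ such that $\rho(\zeta_{a,v,c})=[r_0,r_1,\dots]$ and, for every $m\in\mathbb{N}$, $(a,v)=\mathcal{T}_c^m(a_{-m},v_{-m})$ for some $(a_{-m},v_{-m})$ with $\rho(\zeta_{a_{-m},v_{-m},c})=[r_{-2m},\dots,r_0,r_1,\dots]$. $\mathcal{A}_c$ is the set of all these points. $\|\cdot\|$ is the Euclidean norm on $\mathbb{R}^2$. $D\mathcal{T}_c$-invariance means $D\mathcal{T}_c|_z(E^{u}_z)=E^{u}_{\mathcal{T}_c(z)}$ and $D\mathcal{T}_c|_z(E^{s}_z)=E^{s}_{\mathcal{T}_c(z)}$. *)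

theory Defs
  imports "HOL-Analysis.Analysis"
begin

text \<open>
  A parameter point is a pair \<open>p = (a, v)\<close>; the norm on \<^typ>\<open>real \<times> real\<close> is the Euclidean one.
\<close>

definition param_dom :: "real \<Rightarrow> (real \<times> real) set" where
  "param_dom c = {(a, v). 0 < a \<and> a \<le> c \<and> a + v > c - 1}"

definition strip :: "real \<Rightarrow> (real \<times> real) set" where
  "strip c = {(a, v) \<in> param_dom c.
     if c > 1 then 0 \<le> v \<and> v \<le> c - 1 else c - 1 \<le> v \<and> v \<le> 0}"

definition branchF :: "real \<Rightarrow> real \<times> real \<Rightarrow> real \<Rightarrow> real" where
  "branchF c = (\<lambda>(a, v) x. (a + c * x) / (1 - v * x))"

text \<open>
  The branch \<open>G\<close> of the pair \<open>(F, G)\<close> does not occur below: the height depends only on the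
  \<open>F\<close>-orbit of \<open>-1\<close>, and the parameters of the renormalized pair are read off from that orbit.
  Up to the time given by the height, this orbit stays in \<open>[-1, a]\<close>, and \<open>F\<close> is only applied to
  points of \<open>[-1, 0]\<close>, where its denominator is positive.

  Points outside the parameter domain have height \<open>\<infinity>\<close>; this covers the degenerate case
  \<open>a = 0\<close> reached when renormalizing a pair with \<open>F\<^sup>r(-1) = 0\<close>.
\<close>

definition is_height :: "real \<Rightarrow> real \<times> real \<Rightarrow> nat \<Rightarrow> bool" where
  "is_height c p r \<longleftrightarrow>
     1 \<le> r \<and> (branchF c p ^^ r) (-1) \<le> 0 \<and> 0 < (branchF c p ^^ (r + 1)) (-1)"

definition height :: "real \<Rightarrow> real \<times> real \<Rightarrow> enat" where
  "height c p =
     (if p \<in> param_dom c \<and> (\<exists>r. is_height c p r) then enat (LEAST r. is_height c p r) else \<infinity>)"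

text \<open>
  The renormalization operator from parameters for \<open>c\<close> to parameters for \<open>1 / c\<close>; its value is
  meaningful only for points of finite height.
\<close>

definition renorm :: "real \<Rightarrow> real \<times> real \<Rightarrow> real \<times> real" where
  "renorm c p =
     (let r = the_enat (height c p);
          a' = - (branchF c p ^^ r) (-1) / fst p;
          b' = (branchF c p ^^ (r + 1)) (-1) / fst p;
          v' = (1 / c - a' - b') / b'
      in (a', v'))"

definition renorm2 :: "real \<Rightarrow> real \<times> real \<Rightarrow> real \<times> real" where
  "renorm2 c = renorm (1 / c) \<circ> renorm c"

primrec heights :: "real \<Rightarrow> real \<times> real \<Rightarrow> nat \<Rightarrow> enat" where
  "heights c p 0 = height c p"
| "heights c p (Suc n) = (if height c p = \<infinity> then \<infinity> else heights (1 / c) (renorm c p) n)"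

text \<open>
  \<open>cf_conv n h = 1 / (h 0 + 1 / (h 1 + \<cdots> + 1 / h (n - 1)))\<close>, with \<open>1 / \<infinity> = 0\<close>; a term \<open>\<infinity>\<close> ends
  the fraction, so that terms after it play no role.
\<close>

primrec cf_conv :: "nat \<Rightarrow> (nat \<Rightarrow> enat) \<Rightarrow> real" where
  "cf_conv 0 h = 0"
| "cf_conv (Suc n) h =
     (case h 0 of enat k \<Rightarrow> 1 / (real k + cf_conv n (\<lambda>i. h (Suc i))) | \<infinity> \<Rightarrow> 0)"

definition cf_value :: "(nat \<Rightarrow> enat) \<Rightarrow> real" where
  "cf_value h = lim (\<lambda>n. cf_conv n h)"

definition rotation_number :: "real \<Rightarrow> real \<times> real \<Rightarrow> real" where
  "rotation_number c p = cf_value (heights c p)"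

definition attractor_point :: "real \<Rightarrow> (int \<Rightarrow> nat) \<Rightarrow> real \<times> real \<Rightarrow> bool" where
  "attractor_point c r p \<longleftrightarrow>
     p \<in> strip c \<and>
     rotation_number c p = cf_value (\<lambda>i. enat (r (int i))) \<and>
     (\<forall>m\<ge>1. \<exists>q \<in> param_dom c.
        p = (renorm2 c ^^ m) q \<and>
        rotation_number c q = cf_value (\<lambda>i. enat (r (int i - 2 * int m))))"

text \<open>
  For \<open>1/2 < c < 2\<close>, \<open>c \<noteq> 1\<close>, each sequence \<open>r\<close> of positive integers has exactly one attractor
  point; the attractor is the set of all of them.
\<close>

definition attractor :: "real \<Rightarrow> (real \<times> real) set" where
  "attractor c = {p. \<exists>r. (\<forall>i. 1 \<le> r i) \<and> attractor_point c r p}"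

definition is_splitting :: "'a::real_vector set \<Rightarrow> 'a set \<Rightarrow> bool" where
  "is_splitting U S \<longleftrightarrow>
     subspace U \<and> subspace S \<and> U \<inter> S = {0} \<and> {u + s | u s. u \<in> U \<and> s \<in> S} = UNIV"

end

theory Submission
  imports Defs
begin

text \<open>
  Hyperbolicity holds on the larger set of all points of the strip that are renormalizable
  infinitely often. Renormalization splits into
  slow steps \<open>(F, G) \<mapsto> (F, F \<circ> G)\<close> and a final swap, and in the parameters \<open>(a, v)\<close> each of them
  is an explicit rational map. Their derivatives map a cone of nearly horizontal vectors into itself
  and pull a cone of nearly vertical ones back into itself. On the first cone \<open>|da| / a\<close> expands,
  on the second \<open>|dv|\<close>, divided by a bounded factor, contracts, with rates that are uniform in the
  heights. The action on the slopes is monotone, so the Knaster-Tarski fixed point theorem gives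
  invariant line fields inside the cones.
\<close>

section \<open>Continued fractions\<close>

text \<open>Heights are unbounded, so every rate must be uniform in the number of slow steps. Slow
  steps give only nonstrict inequalities in the adapted lengths; each uniform factor comes from a
  turn. With \<open>C = max c (1 / c)\<close>, a turn expands by at least
  \<open>1 + 1 / (1 + C)\<close>. It contracts by \<open>C / (1 + C)\<close> if its parameter
  exceeds 1, which holds for exactly one of the two turns in \<open>renorm2\<close>. The adapted
  lengths must also be compared with the Euclidean norm. The length \<open>|da| / a\<close>
  degenerates as \<open>a\<close> tends to 0, but at a turn the growth times the new
  \<open>a\<close> is bounded below, so the last turn repairs the loss. The stable weight is at
  least 1 everywhere and at most \<open>C^2\<close> right after a turn. The constants that remain
  are absorbed by a high iterate. Continued fractions serve to turn an equation between rotation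
  numbers into infinitely many finite heights: the prescribed value is irrational.\<close>

lemma cf_conv_bounds:
  assumes "\<And>i. h i \<noteq> 0"
  shows "0 \<le> cf_conv n h \<and> cf_conv n h \<le> 1"
  using assms
proof (induction n arbitrary: h)
  case (Suc n)
  have IH: "0 \<le> cf_conv n (\<lambda>i. h (Suc i))" using Suc by auto
  show ?case
  proof (cases "h 0")
    case (enat k)
    then have "k \<ge> 1" using Suc.prems[of 0] by (cases k) (auto simp: zero_enat_def)
    then show ?thesis using IH enat by (simp add: divide_le_eq_1)
  qed simp
qed simp

lemma cf_conv_rat: "cf_conv n h \<in> \<rat>"
  by (induction n arbitrary: h) (auto split: enat.splits)

lemma cf_conv_stop:
  assumes "h n = \<infinity>" "m > n"
  shows "cf_conv m h = cf_conv (Suc n) h"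
  using assms
proof (induction n arbitrary: h m)
  case 0
  then show ?case by (cases m) auto
next
  case (Suc n)
  then obtain m' where m: "m = Suc m'" by (cases m) auto
  have "cf_conv m' (\<lambda>i. h (Suc i)) = cf_conv (Suc n) (\<lambda>i. h (Suc i))"
    using Suc.prems m by (intro Suc.IH) auto
  then show ?case unfolding m by (simp split: enat.splits)
qed

text \<open>An infinite term cuts the fraction off, so the convergents are eventually equal to one
  rational number.\<close>

lemma cf_value_rat:
  assumes "h n = \<infinity>"
  shows "cf_value h \<in> \<rat>"
proof -
  have "\<forall>\<^sub>F m in sequentially. cf_conv m h = cf_conv (Suc n) h"
    using eventually_gt_at_top[of n] by eventually_elim (rule cf_conv_stop[where h = h, OF assms])
  then have "(\<lambda>m. cf_conv m h) \<longlonglongrightarrow> cf_conv (Suc n) h"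
    by (rule tendsto_eventually)
  then show ?thesis
    unfolding cf_value_def by (simp only: limI cf_conv_rat)
qed

text \<open>One step \<open>1 / (k + x)\<close> has derivative of modulus 1 at \<open>k = 1\<close>,
  \<open>x = 0\<close>. After two steps both denominators \<open>A\<close>, \<open>B\<close> are at
  least 2, whence the factor 1/4.\<close>

lemma recip_two_step_contraction:
  fixes x y :: real and k l :: nat
  assumes "k \<ge> 1" "l \<ge> 1" "0 \<le> x" "0 \<le> y"
  shows "\<bar>1 / (k + 1 / (l + x)) - 1 / (k + 1 / (l + y))\<bar> \<le> \<bar>x - y\<bar> / 4"
proof -
  define A where "A = k * (l + x) + 1"
  define B where "B = k * (l + y) + 1"
  have kl: "real k * l \<ge> 1" using assms(1,2) by (simp add: mult_ge1_I)
  have "0 \<le> real k * x" "0 \<le> real k * y" using assms by auto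
  then have "k * (l + x) \<ge> 1" "k * (l + y) \<ge> 1"
    using kl by (auto simp: distrib_left)
  then have A: "A \<ge> 2" and B: "B \<ge> 2" by (auto simp: A_def B_def)
  have pos: "l + x > 0" "l + y > 0" using assms by auto
  have "k + 1 / (l + x) = A / (l + x)" "k + 1 / (l + y) = B / (l + y)"
    using pos by (auto simp: A_def B_def field_simps)
  then have "1 / (k + 1 / (l + x)) - 1 / (k + 1 / (l + y)) = ((l + x) * B - (l + y) * A) / (A * B)"
    using A B by (simp add: diff_frac_eq)
  also have "(l + x) * B - (l + y) * A = x - y"
    by (simp add: A_def B_def algebra_simps)
  finally have "\<bar>1 / (k + 1 / (l + x)) - 1 / (k + 1 / (l + y))\<bar> = \<bar>x - y\<bar> / (A * B)"
    using A B by (simp add: abs_mult)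
  also have "\<dots> \<le> \<bar>x - y\<bar> / 4"
    using mult_mono[OF A B] A by (intro divide_left_mono) auto
  finally show ?thesis .
qed

lemma cf_conv_cauchy:
  fixes r :: "nat \<Rightarrow> nat"
  assumes "\<And>i. r i \<ge> 1"
  shows "\<bar>cf_conv (2 * n + m) (\<lambda>i. enat (r i)) - cf_conv (2 * n + m') (\<lambda>i. enat (r i))\<bar> \<le> (1/4) ^ n"
  using assms
proof (induction n arbitrary: r)
  case 0
  have "enat (r i) \<noteq> 0" for i using 0[of i] by (auto simp: zero_enat_def)
  then show ?case
    using cf_conv_bounds[of "\<lambda>i. enat (r i)" m] cf_conv_bounds[of "\<lambda>i. enat (r i)" m']
    by auto
next
  case (Suc n)
  let ?h = "\<lambda>i. enat (r (Suc (Suc i)))"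
  have "enat (r i) \<noteq> 0" for i using Suc.prems[of i] by (auto simp: zero_enat_def)
  then have "0 \<le> cf_conv (2 * n + m) ?h" "0 \<le> cf_conv (2 * n + m') ?h"
    using cf_conv_bounds[of ?h] by auto
  from recip_two_step_contraction[OF Suc.prems[of 0] Suc.prems[of 1] this]
  have "\<bar>cf_conv (2 * Suc n + m) (\<lambda>i. enat (r i)) - cf_conv (2 * Suc n + m') (\<lambda>i. enat (r i))\<bar>
      \<le> \<bar>cf_conv (2 * n + m) ?h - cf_conv (2 * n + m') ?h\<bar> / 4"
    by simp
  also have "\<dots> \<le> (1/4) ^ Suc n"
    using Suc.IH[of "\<lambda>i. r (Suc (Suc i))"] Suc.prems by simp
  finally show ?case .
qed

lemma cf_conv_tendsto:
  fixes r :: "nat \<Rightarrow> nat"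
  assumes "\<And>i. r i \<ge> 1"
  shows "(\<lambda>n. cf_conv n (\<lambda>i. enat (r i))) \<longlonglongrightarrow> cf_value (\<lambda>i. enat (r i))"
proof -
  have "Cauchy (\<lambda>n. cf_conv n (\<lambda>i. enat (r i)))"
  proof (rule metric_CauchyI)
    fix e :: real assume "0 < e"
    then obtain n where n: "(1/4 :: real) ^ n < e"
      using real_arch_pow_inv[of e "1/4"] by auto
    show "\<exists>M. \<forall>m\<ge>M. \<forall>m'\<ge>M. dist (cf_conv m (\<lambda>i. enat (r i))) (cf_conv m' (\<lambda>i. enat (r i))) < e"
    proof (intro exI allI impI)
      fix m m' assume "m \<ge> 2 * n" "m' \<ge> 2 * n"
      then show "dist (cf_conv m (\<lambda>i. enat (r i))) (cf_conv m' (\<lambda>i. enat (r i))) < e"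
        using cf_conv_cauchy[of r n "m - 2 * n" "m' - 2 * n"] assms n
        by (simp add: dist_real_def)
    qed
  qed
  then show ?thesis
    unfolding cf_value_def using Cauchy_convergent convergent_LIMSEQ_iff by blast
qed

lemma cf_value_bounds:
  fixes r :: "nat \<Rightarrow> nat"
  assumes "\<And>i. r i \<ge> 1"
  shows "0 \<le> cf_value (\<lambda>i. enat (r i)) \<and> cf_value (\<lambda>i. enat (r i)) \<le> 1"
proof -
  have "enat (r i) \<noteq> 0" for i using assms[of i] by (auto simp: zero_enat_def)
  then have *: "0 \<le> cf_conv n (\<lambda>i. enat (r i)) \<and> cf_conv n (\<lambda>i. enat (r i)) \<le> 1" for n
    using cf_conv_bounds[of "\<lambda>i. enat (r i)" n] by auto
  show ?thesis
    using LIMSEQ_le_const[OF cf_conv_tendsto[of r, OF assms], where a = 0]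
      LIMSEQ_le_const2[OF cf_conv_tendsto[of r, OF assms], where a = 1] * by auto
qed

lemma cf_value_unfold:
  fixes r :: "nat \<Rightarrow> nat"
  assumes "\<And>i. r i \<ge> 1"
  shows "cf_value (\<lambda>i. enat (r i)) = 1 / (r 0 + cf_value (\<lambda>i. enat (r (Suc i))))"
proof -
  have "r 0 + cf_value (\<lambda>i. enat (r (Suc i))) \<noteq> 0"
    using cf_value_bounds[of "\<lambda>i. r (Suc i)"] assms assms[of 0] by fastforce
  then have "(\<lambda>n. 1 / (r 0 + cf_conv n (\<lambda>i. enat (r (Suc i))))) \<longlonglongrightarrow>
      1 / (r 0 + cf_value (\<lambda>i. enat (r (Suc i))))"
    using assms by (intro tendsto_intros cf_conv_tendsto) auto
  moreover have "(\<lambda>n. cf_conv (Suc n) (\<lambda>i. enat (r i))) \<longlonglongrightarrow> cf_value (\<lambda>i. enat (r i))"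
    using cf_conv_tendsto[of r, OF assms] by (rule LIMSEQ_Suc)
  ultimately show ?thesis
    using LIMSEQ_unique by fastforce
qed

lemma cf_value_strict_bounds:
  fixes r :: "nat \<Rightarrow> nat"
  assumes r: "\<And>i. r i \<ge> 1"
  shows "0 < cf_value (\<lambda>i. enat (r i)) \<and> cf_value (\<lambda>i. enat (r i)) < 1"
proof -
  have pos: "0 < cf_value (\<lambda>i. enat (s i))" if s: "\<And>i. s i \<ge> 1" for s :: "nat \<Rightarrow> nat"
  proof -
    have "0 \<le> cf_value (\<lambda>i. enat (s (Suc i)))"
      by (rule cf_value_bounds[THEN conjunct1]) (rule s)
    moreover have "1 \<le> s 0" by (rule s)
    ultimately have "0 < s 0 + cf_value (\<lambda>i. enat (s (Suc i)))" by linarith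
    then show ?thesis unfolding cf_value_unfold[of s, OF s] by simp
  qed
  have "0 < cf_value (\<lambda>i. enat (r (Suc i)))" by (rule pos) (rule r)
  moreover have "1 \<le> r 0" by (rule r)
  ultimately have "1 < r 0 + cf_value (\<lambda>i. enat (r (Suc i)))" by linarith
  then have "cf_value (\<lambda>i. enat (r i)) < 1" unfolding cf_value_unfold[of r, OF r] by simp
  then show ?thesis using pos[of r, OF r] by simp
qed

text \<open>Infinite descent: if the value is \<open>p / q\<close>, then the value of the tail is
  \<open>(q - p * r 0) / p\<close>, whose denominator \<open>p\<close> is smaller than
  \<open>q\<close>.\<close>

lemma cf_value_irrational:
  fixes r :: "nat \<Rightarrow> nat"
  assumes "\<And>i. r i \<ge> 1"
  shows "cf_value (\<lambda>i. enat (r i)) \<notin> \<rat>"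
proof
  have descent: False
    if "\<And>i. r i \<ge> 1" "cf_value (\<lambda>i. enat (r i)) = real p / real q" "q > 0"
    for r :: "nat \<Rightarrow> nat" and p q :: nat
    using that
  proof (induction q arbitrary: r p rule: less_induct)
    case (less q)
    let ?x = "cf_value (\<lambda>i. enat (r i))" and ?y = "cf_value (\<lambda>i. enat (r (Suc i)))"
    have x: "0 < ?x" "?x < 1" using cf_value_strict_bounds[of r, OF less.prems(1)] by auto
    then have p: "0 < p" "p < q" using less.prems(2,3) by (auto simp: field_simps)
    have y: "0 < ?y" using cf_value_strict_bounds[of "\<lambda>i. r (Suc i)"] less.prems(1) by auto
    have "real p / real q = 1 / (r 0 + ?y)"
      using cf_value_unfold[of r, OF less.prems(1)] less.prems(2) by metis
    moreover have "0 < r 0 + ?y" using y by simp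
    ultimately have "p * (r 0 + ?y) = q"
      using less.prems(3) by (simp add: frac_eq_eq)
    then have py: "p * ?y = real q - real p * r 0" by (simp add: distrib_left)
    then have eq: "?y = (real q - real p * r 0) / p"
      using p by (simp add: eq_divide_eq mult.commute)
    have "0 < p * ?y" using p y by simp
    then have "real q > real p * r 0" unfolding py by simp
    then have "real q - real p * r 0 = real (q - p * r 0)"
      by (simp flip: of_nat_mult add: of_nat_diff)
    then have "?y = real (q - p * r 0) / real p" using eq by simp
    from less.IH[OF p(2) less.prems(1) this p(1)] show False .
  qed
  assume "cf_value (\<lambda>i. enat (r i)) \<in> \<rat>"
  then obtain p q :: nat where pq: "q \<noteq> 0" "\<bar>cf_value (\<lambda>i. enat (r i))\<bar> = real p / real q"
    by (rule Rats_abs_nat_div_natE)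
  then show False
    using descent[of r p q] assms cf_value_strict_bounds[of r, OF assms] by auto
qed

section \<open>Invariant sections\<close>

text \<open>Knaster-Tarski on functions with values in the unit interval: \<open>f\<close> is the
  greatest fixed point, the pointwise supremum of all \<open>g\<close> with
  \<open>g \<le> \<Phi> g\<close>.\<close>

lemma unit_interval_fixpoint:
  fixes \<Phi> :: "('a \<Rightarrow> real) \<Rightarrow> 'a \<Rightarrow> real"
  assumes range: "\<And>f. range f \<subseteq> {0..1} \<Longrightarrow> range (\<Phi> f) \<subseteq> {0..1}"
    and mono: "\<And>f g. \<lbrakk>range f \<subseteq> {0..1}; range g \<subseteq> {0..1}; f \<le> g\<rbrakk> \<Longrightarrow> \<Phi> f \<le> \<Phi> g"
  obtains f where "range f \<subseteq> {0..1}" "\<Phi> f = f"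
proof -
  define G where "G = {g. range g \<subseteq> {0..1} \<and> g \<le> \<Phi> g}"
  define f where "f x = (SUP g\<in>G. g x)" for x
  have "(\<lambda>_. 0) \<in> G"
    using range[of "\<lambda>_. 0"] by (auto simp: G_def le_fun_def image_subset_iff)
  then have ne: "G \<noteq> {}" by auto
  have le1: "g x \<le> 1" if "g \<in> G" for g x
    using that by (auto simp: G_def image_subset_iff)
  have bdd: "bdd_above ((\<lambda>g. g x) ` G)" for x
    using le1 by (auto intro!: bdd_aboveI2)
  have upper: "g \<le> f" if "g \<in> G" for g
    unfolding f_def le_fun_def using that by (auto intro!: cSUP_upper bdd)
  have "f x \<le> 1" for x
    unfolding f_def using ne le1 by (auto intro!: cSUP_least)
  moreover have "0 \<le> f x" for x
    using upper[OF \<open>(\<lambda>_. 0) \<in> G\<close>] by (auto simp: le_fun_def)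
  ultimately have f: "range f \<subseteq> {0..1}" by auto
  have "g \<le> \<Phi> f" if "g \<in> G" for g
    using mono[OF _ f upper[OF that]] that by (auto simp: G_def intro: order_trans)
  then have post: "f \<le> \<Phi> f"
    unfolding le_fun_def f_def using ne by (auto intro!: cSUP_least simp: le_fun_def)
  then have "\<Phi> f \<in> G"
    using range[OF f] mono[OF f range[OF f] post] by (auto simp: G_def)
  then show thesis
    using that[OF f] upper post by (simp add: antisym)
qed

text \<open>The value at \<open>x\<close> is prescribed by the value at \<open>U x\<close>, one
  equation per point, so this is directly a monotone fixed point problem. Off \<open>X\<close> the
  section is 0 by default. It yields the stable line field.\<close>

lemma backward_section:
  fixes h :: "'a \<Rightarrow> real \<Rightarrow> real"
  assumes range: "\<And>x t. \<lbrakk>x \<in> X; 0 \<le> t; t \<le> 1\<rbrakk> \<Longrightarrow> h x t \<in> {0..1}"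
    and mono: "\<And>x s t. \<lbrakk>x \<in> X; 0 \<le> s; s \<le> t; t \<le> 1\<rbrakk> \<Longrightarrow> h x s \<le> h x t"
  obtains g where "range g \<subseteq> {0..1}" "\<And>x. x \<in> X \<Longrightarrow> g x = h x (g (U x))"
proof -
  define \<Phi> where "\<Phi> f x = (if x \<in> X then h x (f (U x)) else 0)" for f :: "'a \<Rightarrow> real" and x
  obtain g where "range g \<subseteq> {0..1}" "\<Phi> g = g"
  proof (rule unit_interval_fixpoint)
    show "range (\<Phi> f) \<subseteq> {0..1}" if "range f \<subseteq> {0..1}" for f
      using that range by (auto simp: \<Phi>_def image_subset_iff)
    show "\<Phi> f \<le> \<Phi> g" if "range f \<subseteq> {0..1}" "range g \<subseteq> {0..1}" "f \<le> g" for f g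
      using that mono by (auto simp: \<Phi>_def le_fun_def image_subset_iff)
  qed
  moreover from this have "g x = h x (g (U x))" if "x \<in> X" for x
    using fun_cong[of "\<Phi> g" g x] that unfolding \<Phi>_def by simp
  ultimately show thesis using that[of g] by blast
qed

text \<open>
  The section is made to vanish on \<open>Z\<close>, which reconciles the values forced at points with several
  preimages.
\<close>

lemma forward_section:
  fixes h :: "'a \<Rightarrow> real \<Rightarrow> real"
  assumes range: "\<And>x t. \<lbrakk>x \<in> X; 0 \<le> t; t \<le> 1\<rbrakk> \<Longrightarrow> h x t \<in> {0..1}"
    and mono: "\<And>x s t. \<lbrakk>x \<in> X; 0 \<le> s; s \<le> t; t \<le> 1\<rbrakk> \<Longrightarrow> h x s \<le> h x t"
    and collision: "\<And>x y. \<lbrakk>x \<in> X; y \<in> X; U x = U y\<rbrakk> \<Longrightarrow>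
      x = y \<or> x \<in> Z \<and> y \<in> Z \<and> h x 0 = h y 0"
    and zero: "\<And>x. \<lbrakk>x \<in> X; U x \<in> Z\<rbrakk> \<Longrightarrow> x \<in> Z \<and> h x 0 = 0"
  obtains f where "range f \<subseteq> {0..1}" "\<And>x. x \<in> X \<Longrightarrow> f (U x) = h x (f x)"
proof -
  define pre where "pre y = (SOME x. x \<in> X \<and> U x = y)" for y
  define \<Phi> where "\<Phi> f y = (if y \<in> Z \<or> y \<notin> U ` X then 0 else h (pre y) (f (pre y)))"
    for f :: "'a \<Rightarrow> real" and y
  have pre: "pre y \<in> X \<and> U (pre y) = y" if "y \<in> U ` X" for y
  proof -
    have "\<exists>x. x \<in> X \<and> U x = y" using that by auto
    then show ?thesis unfolding pre_def by (rule someI_ex)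
  qed
  obtain f where f: "range f \<subseteq> {0..1}" "\<Phi> f = f"
  proof (rule unit_interval_fixpoint)
    show "range (\<Phi> f) \<subseteq> {0..1}" if "range f \<subseteq> {0..1}" for f
      using that range pre by (auto simp: \<Phi>_def image_subset_iff)
    show "\<Phi> f \<le> \<Phi> g" if "range f \<subseteq> {0..1}" "range g \<subseteq> {0..1}" "f \<le> g" for f g
      using that mono pre by (auto simp: \<Phi>_def le_fun_def image_subset_iff)
  qed
  have fZ: "f z = 0" if "z \<in> Z" for z
    using fun_cong[OF f(2), of z] that by (simp add: \<Phi>_def)
  have "f (U x) = h x (f x)" if x: "x \<in> X" for x
  proof (cases "U x \<in> Z")
    case True
    then show ?thesis using zero[OF x] fZ by auto
  next
    case False
    then have "f (U x) = h (pre (U x)) (f (pre (U x)))"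
      using fun_cong[OF f(2), of "U x"] x by (simp add: \<Phi>_def)
    moreover have "pre (U x) = x \<or> pre (U x) \<in> Z \<and> x \<in> Z \<and> h (pre (U x)) 0 = h x 0"
      using pre[of "U x"] x by (intro collision) auto
    ultimately show ?thesis using fZ by auto
  qed
  then show thesis using that f(1) by blast
qed

section \<open>Slow steps\<close>

text \<open>
  \<open>gap c p\<close> is the paper's \<open>b\<close>. The slow step \<open>slow\<close> replaces \<open>(F, G)\<close> by \<open>(F, F \<circ> G)\<close>
  and rescales by \<open>b\<close>, which keeps \<open>c\<close>; \<open>turn\<close> does the same and then swaps the two branches,
  which changes \<open>c\<close> to \<open>1 / c\<close>. Renormalization with height \<open>k + 1\<close> is \<open>turn\<close> after \<open>k\<close> slow steps.
\<close>

definition gap :: "real \<Rightarrow> real \<times> real \<Rightarrow> real" where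
  "gap c p = (c - fst p) / (1 + snd p)"

definition slow :: "real \<Rightarrow> real \<times> real \<Rightarrow> real \<times> real" where
  "slow c p = (fst p / gap c p, snd p * gap c p)"

definition turn :: "real \<Rightarrow> real \<times> real \<Rightarrow> real \<times> real" where
  "turn c p = (gap c p / fst p, (1 + snd p * gap c p) / c - 1)"

text \<open>Leaving out \<open>a = c\<close>, where \<open>gap\<close> vanishes and
  \<open>F(-1) = 0\<close>, makes the domain open.\<close>

definition inner_dom :: "real \<Rightarrow> (real \<times> real) set" where
  "inner_dom c = {p. 0 < fst p \<and> fst p < c \<and> c - 1 < fst p + snd p}"

text \<open>The points of height \<open>k + 1\<close> whose renormalization has
  \<open>a' > 0\<close>. Strict inequalities exclude the points where the orbit of -1 hits 0, so
  these sets are open.\<close>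

primrec slow_times :: "nat \<Rightarrow> real \<Rightarrow> (real \<times> real) set" where
  "slow_times 0 c = {p \<in> inner_dom c. c * gap c p < fst p}"
| "slow_times (Suc k) c = {p \<in> inner_dom c. fst p < c * gap c p \<and> slow c p \<in> slow_times k c}"

lemma inner_dom_gap:
  assumes "p \<in> inner_dom c"
  shows "0 < gap c p" "gap c p < 1" "0 < 1 + snd p" "0 < c" "0 < c + fst p * snd p"
    "c = fst p + gap c p * (1 + snd p)"
proof -
  have p: "0 < fst p" "fst p < c" "c - 1 < fst p + snd p"
    using assms by (auto simp: inner_dom_def)
  then show v: "0 < 1 + snd p" and "0 < c" by auto
  then show "0 < gap c p" "gap c p < 1" "c = fst p + gap c p * (1 + snd p)"
    using p by (auto simp: gap_def field_simps)
  \<comment> \<open>Replacing \<open>v\<close> by its lower bound \<open>c - 1 - a\<close> turns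
    \<open>c + a * v\<close>, the numerator of \<open>F'\<close>, into
    \<open>(c - a) * (1 + a)\<close>.\<close>
  have "0 < (c - fst p) * (1 + fst p)" using p by auto
  also have "\<dots> \<le> c + fst p * snd p"
    using mult_left_mono[of "c - 1 - fst p" "snd p" "fst p"] p by (simp add: algebra_simps)
  finally show "0 < c + fst p * snd p" .
qed

text \<open>The condition that needs an argument is \<open>c - 1 < a / b + v * b\<close>: multiplied
  by \<open>b * (1 + v)\<close>, the difference of its sides factors as
  \<open>(c + a * v) * (1 - b)\<close>.\<close>

lemma slow_inner_dom:
  assumes "p \<in> inner_dom c" "fst p < c * gap c p"
  shows "slow c p \<in> inner_dom c"
proof -
  obtain a v b where p: "p = (a, v)" and b: "b = gap c p" by (cases p) auto
  note g = inner_dom_gap[OF assms(1), folded b, unfolded p fst_conv snd_conv]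
  have a: "0 < a" using assms p by (auto simp: inner_dom_def)
  have "(a / b + v * b + 1 - (a + b * (1 + v))) * (b * (1 + v)) = (a + b * (1 + v) + a * v) * (1 - b)"
    using g(1) by (simp add: field_simps)
  then have "0 < (a / b + v * b + 1 - c) * (b * (1 + v))" using g(2,5,6) by simp
  then have "0 < a / b + v * b + 1 - c"
    using mult_pos_pos[OF g(1,3)] by (rule zero_less_mult_pos2)
  then show ?thesis
    using assms(2) a g(1) p b by (auto simp: inner_dom_def slow_def field_simps)
qed

lemma branchF_slow:
  assumes "gap c p \<noteq> 0"
  shows "(branchF c p ^^ n) (gap c p * x) = gap c p * (branchF c (slow c p) ^^ n) x"
proof (induction n)
  case (Suc n)
  have "branchF c p (gap c p * y) = gap c p * branchF c (slow c p) y" for y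
  proof -
    have "fst p + c * (gap c p * y) = gap c p * (fst p / gap c p + c * y)"
      using assms by (simp add: field_simps)
    then show ?thesis by (simp add: branchF_def slow_def case_prod_beta mult.assoc)
  qed
  then show ?case using Suc by simp
qed simp

lemma branchF_minus_one: "branchF c p (-1) = - gap c p"
  by (cases p) (simp add: branchF_def gap_def field_simps minus_divide_left)

text \<open>\<open>F\<close> sends -1 to \<open>-b\<close>, and rescaling by \<open>b\<close> moves
  \<open>-b\<close> back to -1. So a slow step shifts the orbit of -1 by one, which lowers heights
  by one.\<close>

lemma branchF_orbit_Suc:
  assumes "gap c p \<noteq> 0"
  shows "(branchF c p ^^ Suc n) (-1) = gap c p * (branchF c (slow c p) ^^ n) (-1)"
  using branchF_slow[OF assms, of n "-1"] by (simp add: funpow_Suc_right branchF_minus_one del: funpow.simps)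

lemma gap_slow: "gap c (slow c p) = (c - fst p / gap c p) / (1 + snd p * gap c p)"
  by (subst gap_def) (simp add: slow_def)

text \<open>Since \<open>F^2(-1)\<close> equals \<open>- gap c p * gap c (slow c p)\<close>, this
  sign decides between a slow step and a turn.\<close>

lemma gap_slow_sign:
  assumes "p \<in> inner_dom c"
  shows "gap c (slow c p) < 0 \<longleftrightarrow> c * gap c p < fst p"
    and "gap c (slow c p) = 0 \<longleftrightarrow> c * gap c p = fst p"
proof -
  note g = inner_dom_gap[OF assms]
  have "gap c p < 1" "0 < gap c p" using g by auto
  have "0 < 1 + snd p * gap c p"
  proof (cases "0 \<le> snd p")
    case False
    then have "snd p * 1 \<le> snd p * gap c p" using g by (intro mult_left_mono_neg) auto
    then show ?thesis using g by simp
  qed (use g in \<open>auto intro: add_pos_nonneg\<close>)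
  then show "gap c (slow c p) < 0 \<longleftrightarrow> c * gap c p < fst p"
    "gap c (slow c p) = 0 \<longleftrightarrow> c * gap c p = fst p"
    using g(1) unfolding gap_slow
    by (simp_all add: divide_less_0_iff less_divide_eq eq_divide_eq not_less_iff_gr_or_eq)
qed

section \<open>Heights and renormalization in terms of slow steps\<close>

lemma is_height_one:
  assumes "p \<in> inner_dom c"
  shows "is_height c p 1 \<longleftrightarrow> c * gap c p < fst p"
proof -
  have "(branchF c p ^^ (1 + 1)) (-1) = gap c p * - gap c (slow c p)"
    using branchF_orbit_Suc[of c p 1] inner_dom_gap(1)[OF assms] by (simp add: branchF_minus_one)
  then show ?thesis
    using gap_slow_sign[OF assms] inner_dom_gap(1)[OF assms]
    by (simp add: is_height_def branchF_minus_one zero_less_mult_iff mult_less_0_iff)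
qed

lemma is_height_Suc:
  assumes "p \<in> inner_dom c" "1 \<le> r"
  shows "is_height c p (Suc r) \<longleftrightarrow> is_height c (slow c p) r"
proof -
  have "0 < gap c p" using inner_dom_gap[OF assms(1)] by auto
  then show ?thesis
    using branchF_orbit_Suc[of c p r] branchF_orbit_Suc[of c p "Suc r"] assms(2)
    by (simp add: is_height_def zero_less_mult_iff mult_le_0_iff del: funpow.simps)
qed

lemma inner_dom_param_dom: "inner_dom c \<subseteq> param_dom c"
  by (auto simp: inner_dom_def param_dom_def)

lemma not_is_height_0: "\<not> is_height c p 0"
  by (simp add: is_height_def)

text \<open>Existence and minimality go through one induction, because the step compares all heights
  at \<open>p\<close> with those at \<open>slow c p\<close>.\<close>

lemma least_height_slow_times:
  assumes "p \<in> slow_times k c"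
  shows "is_height c p (Suc k)" "\<And>r. is_height c p r \<Longrightarrow> Suc k \<le> r"
proof -
  have "is_height c p (Suc k) \<and> (\<forall>r. is_height c p r \<longrightarrow> Suc k \<le> r)"
    using assms
  proof (induction k arbitrary: p)
    case 0
    then show ?case using is_height_one[of p c] not_is_height_0[of c p]
      by (auto simp: Suc_le_eq intro!: gr0I)
  next
    case (Suc k)
    then have p: "p \<in> inner_dom c" "fst p < c * gap c p" "slow c p \<in> slow_times k c" by auto
    have "Suc (Suc k) \<le> r" if "is_height c p r" for r
    proof (cases r)
      case (Suc r')
      then have "1 \<le> r'" using that is_height_one[OF p(1)] p(2) by (cases r') auto
      then show ?thesis using that is_height_Suc[OF p(1)] Suc.IH[OF p(3)] Suc by auto
    qed (use that in \<open>simp add: is_height_def\<close>)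
    then show ?case using is_height_Suc[OF p(1)] Suc.IH[OF p(3)] by auto
  qed
  then show "is_height c p (Suc k)" "\<And>r. is_height c p r \<Longrightarrow> Suc k \<le> r" by auto
qed

lemma slow_times_inner_dom: "slow_times k c \<subseteq> inner_dom c"
  by (cases k) auto

lemma height_slow_times:
  assumes "p \<in> slow_times k c"
  shows "height c p = enat (Suc k)"
proof -
  have "(LEAST r. is_height c p r) = Suc k"
    using least_height_slow_times[OF assms] by (intro Least_equality) auto
  then show ?thesis
    using least_height_slow_times(1)[OF assms]
      subsetD[OF inner_dom_param_dom subsetD[OF slow_times_inner_dom assms]]
    by (auto simp: height_def)
qed

text \<open>The parameters of the renormalized pair depend only on ratios of the orbit to
  \<open>a\<close>, and a slow step scales both by \<open>1 / b\<close>. This reduces the claim to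
  height 1, where \<open>a' = b / a\<close> and \<open>b' = F^2(-1) / a\<close> give
  \<open>turn\<close>.\<close>

lemma renorm_slow_times:
  assumes "p \<in> slow_times k c"
  shows "renorm c p = turn c ((slow c ^^ k) p)"
proof -
  have *: "(- (branchF c p ^^ Suc k) (-1) / fst p,
      (1 / c - - (branchF c p ^^ Suc k) (-1) / fst p - (branchF c p ^^ Suc (Suc k)) (-1) / fst p) /
        ((branchF c p ^^ Suc (Suc k)) (-1) / fst p)) = turn c ((slow c ^^ k) p)"
    using assms
  proof (induction k arbitrary: p)
    case 0
    then have p: "p \<in> inner_dom c" "c * gap c p < fst p" by auto
    note g = inner_dom_gap[OF p(1)]
    let ?b = "gap c p" and ?B = "gap c (slow c p)"
    have a: "0 < fst p" using p by (auto simp: inner_dom_def)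
    have B: "?B < 0" using gap_slow_sign(1)[OF p(1)] p(2) by simp
    have B_eq: "?B * (1 + snd p * ?b) = c - fst p / ?b"
      using B unfolding gap_slow by (cases "1 + snd p * ?b = 0") auto
    have orb: "(branchF c p ^^ Suc (Suc 0)) (-1) = - (?b * ?B)"
      using branchF_orbit_Suc[of c p "Suc 0"] g(1) by (simp add: branchF_minus_one)
    have "(1 / c - ?b / fst p + ?b * ?B / fst p) / (- (?b * ?B) / fst p) = (1 + snd p * ?b) / c - 1"
    proof -
      have "?B * (1 + snd p * ?b) * ?b = c * ?b - fst p"
        using B_eq g(1) by (simp add: field_simps)
      then show ?thesis
        using B a g(1,4) by (simp add: divide_simps) (simp add: algebra_simps)
    qed
    then show ?case using orb by (simp add: turn_def branchF_minus_one)
  next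
    case (Suc k)
    then have p: "p \<in> inner_dom c" "slow c p \<in> slow_times k c" by auto
    have b: "gap c p \<noteq> 0" using inner_dom_gap[OF p(1)] by auto
    have eq: "(branchF c p ^^ Suc n) (-1) / fst p = (branchF c (slow c p) ^^ n) (-1) / fst (slow c p)" for n
      using branchF_orbit_Suc[OF b] by (simp add: slow_def field_simps del: funpow.simps)
    show ?case
      using Suc.IH[OF p(2)]
      unfolding minus_divide_left[symmetric] eq funpow_Suc_right[of k "slow c"] o_apply .
  qed
  show ?thesis
    unfolding renorm_def Let_def height_slow_times[OF assms]
    using * by (simp del: funpow.simps)
qed

text \<open>The condition \<open>a' > 0\<close> says \<open>F^r(-1) < 0\<close> at the height
  \<open>r\<close>. It rules out both ties, \<open>a = c\<close> and \<open>a = c * b\<close>, at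
  every stage.\<close>

lemma finite_height_slow_times:
  assumes "height c p \<noteq> \<infinity>" "fst (renorm c p) > 0"
  shows "\<exists>k. p \<in> slow_times k c"
proof -
  define r where "r = (LEAST r. is_height c p r)"
  have "p \<in> param_dom c \<and> (\<exists>r. is_height c p r)"
    using assms(1) by (auto simp: height_def split: if_splits)
  then have r: "p \<in> param_dom c" "is_height c p r"
      "\<And>s. is_height c p s \<Longrightarrow> r \<le> s" "height c p = enat r"
    by (auto simp: height_def r_def intro: LeastI Least_le)
  have neg: "(branchF c p ^^ r) (-1) < 0"
    using assms(2) r(1) unfolding renorm_def Let_def r(4)
    by (auto simp: param_dom_def divide_less_0_iff)
  have "fst p \<noteq> c"
  proof
    assume "fst p = c"
    then have c: "gap c p = 0" "0 < c" using r(1) by (auto simp: gap_def param_dom_def)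
    then have "(branchF c p ^^ (1 + 1)) (-1) = c"
      using \<open>fst p = c\<close> by (cases p) (simp add: branchF_minus_one, simp add: branchF_def)
    then have "is_height c p 1" using c by (simp add: is_height_def branchF_minus_one)
    then have "r = 1" using r(2) r(3)[of 1] by (auto simp: is_height_def)
    then show False using neg c by (simp add: branchF_minus_one)
  qed
  then have p: "p \<in> inner_dom c" using r(1) by (auto simp: inner_dom_def param_dom_def)
  have "p \<in> slow_times k c"
    if "p \<in> inner_dom c" "is_height c p (Suc k)" "\<And>s. is_height c p s \<Longrightarrow> Suc k \<le> s"
      "(branchF c p ^^ Suc k) (-1) < 0" for k
    using that
  proof (induction k arbitrary: p)
    case 0
    then show ?case using is_height_one[of p c] by simp
  next
    case (Suc k)
    note p = Suc.prems(1)
    have b: "0 < gap c p" using inner_dom_gap[OF p] by auto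
    have "\<not> c * gap c p < fst p" using is_height_one[OF p] Suc.prems(3)[of 1] by auto
    moreover have "c * gap c p \<noteq> fst p"
    \<comment> \<open>A tie means \<open>F^2(-1) = 0\<close> and \<open>F^3(-1) > 0\<close>, so the
      height is 2 and the orbit is at 0 there, against strict negativity.\<close>
    proof
      assume eq: "c * gap c p = fst p"
      then have B: "gap c (slow c p) = 0" using gap_slow_sign[OF p] by simp
      have "branchF c (slow c p) 0 > 0"
        using b p by (auto simp: branchF_def slow_def inner_dom_def)
      then have "is_height c (slow c p) 1" using B by (simp add: is_height_def branchF_minus_one)
      then have "k = 0" using is_height_Suc[OF p, of 1] Suc.prems(3)[of 2] by (simp add: numeral_2_eq_2)
      then show False
        using Suc.prems(4) branchF_orbit_Suc[of c p 1] B b by (simp add: branchF_minus_one)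
    qed
    ultimately have lt: "fst p < c * gap c p" by simp
    have "slow c p \<in> slow_times k c"
    proof (rule Suc.IH)
      show "slow c p \<in> inner_dom c" using p lt by (rule slow_inner_dom)
      show "is_height c (slow c p) (Suc k)" using is_height_Suc[OF p] Suc.prems(2) by simp
      show "Suc k \<le> s" if "is_height c (slow c p) s" for s
      proof -
        have "1 \<le> s" using that by (simp add: is_height_def)
        then show ?thesis using is_height_Suc[OF p] Suc.prems(3)[of "Suc s"] that by simp
      qed
      show "(branchF c (slow c p) ^^ Suc k) (-1) < 0"
        using branchF_orbit_Suc[of c p "Suc k"] Suc.prems(4) b
        by (simp add: mult_less_0_iff del: funpow.simps)
    qed
    then show ?case using lt p by simp
  qed
  moreover have "r = Suc (r - 1)" using r(2) by (simp add: is_height_def)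
  ultimately show ?thesis using r neg p by metis
qed

section \<open>Openness and derivatives\<close>

lemma continuous_on_gap: "continuous_on (inner_dom c) (gap c)"
  unfolding gap_def using inner_dom_gap(3) by (intro continuous_intros) fastforce

lemma continuous_on_slow: "continuous_on (inner_dom c) (slow c)"
  unfolding slow_def using inner_dom_gap(1) by (intro continuous_intros continuous_on_gap) fastforce

lemma open_inner_dom: "open (inner_dom c)"
  unfolding inner_dom_def
  by (intro open_Collect_conj open_Collect_less continuous_intros)

text \<open>Heights are locally constant, so the derivative of \<open>turn c\<close> after
  \<open>k\<close> slow steps is also that of \<open>renorm c\<close>.\<close>

lemma open_slow_times: "open (slow_times k c)"
proof (induction k)
  have cont: "continuous_on (inner_dom c) (\<lambda>p. fst p - c * gap c p)"
    by (intro continuous_intros continuous_on_gap)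
  {
    case 0
    show ?case
      using continuous_open_preimage[OF cont open_inner_dom open_greaterThan[of 0]]
      by (simp add: Int_def vimage_def)
  next
    case (Suc k)
    have "open {p \<in> inner_dom c. fst p < c * gap c p}"
      using continuous_open_preimage[OF cont open_inner_dom open_lessThan[of 0]]
      by (simp add: Int_def vimage_def)
    moreover have "open {p \<in> inner_dom c. slow c p \<in> slow_times k c}"
      using continuous_open_preimage[OF continuous_on_slow open_inner_dom Suc, of c]
      by (simp add: Int_def vimage_def)
    ultimately have "open ({p \<in> inner_dom c. fst p < c * gap c p} \<inter>
        {p \<in> inner_dom c. slow c p \<in> slow_times k c})"
      by (rule open_Int)
    also have "\<dots> = slow_times (Suc k) c" by auto
    finally show ?case .
  }
qed

text \<open>Simplified by \<open>c = a + b * (1 + v)\<close>. If \<open>(A, V)\<close> is the result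
  of \<open>slow\<close>, then \<open>turn\<close> gives \<open>(1 / A, (1 + V) / c - 1)\<close>;
  hence the common numerators of \<open>dslow\<close> and \<open>dturn\<close>.\<close>

definition dslow :: "real \<Rightarrow> real \<times> real \<Rightarrow> real \<times> real \<Rightarrow> real \<times> real" where
  "dslow c p h =
     ((c * fst h + fst p * gap c p * snd h) / ((1 + snd p) * (gap c p)\<^sup>2),
      (gap c p * snd h - snd p * fst h) / (1 + snd p))"

definition dturn :: "real \<Rightarrow> real \<times> real \<Rightarrow> real \<times> real \<Rightarrow> real \<times> real" where
  "dturn c p h =
     (- (c * fst h + fst p * gap c p * snd h) / ((1 + snd p) * (fst p)\<^sup>2),
      (gap c p * snd h - snd p * fst h) / ((1 + snd p) * c))"

lemma gap_has_derivative:
  assumes "0 < 1 + snd p"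
  shows "(gap c has_derivative (\<lambda>h. - (fst h + gap c p * snd h) / (1 + snd p))) (at p)"
  unfolding gap_def[abs_def] using assms
  by (auto intro!: derivative_eq_intros simp: divide_simps gap_def fun_eq_iff algebra_simps power2_eq_square)

lemma slow_has_derivative:
  assumes "p \<in> inner_dom c"
  shows "(slow c has_derivative dslow c p) (at p)"
proof -
  note g = inner_dom_gap[OF assms]
  let ?b = "gap c p"
  note [derivative_intros] = gap_has_derivative[OF g(3)]
  have "((\<lambda>p. (fst p / gap c p, snd p * gap c p)) has_derivative
      (\<lambda>h. ((fst h * ?b - fst p * (- (fst h + ?b * snd h) / (1 + snd p))) / (?b * ?b),
        snd p * (- (fst h + ?b * snd h) / (1 + snd p)) + snd h * ?b))) (at p)"
    using g(1) by (intro derivative_intros has_derivative_divide') auto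
  moreover have "(fst h * ?b - fst p * (- (fst h + ?b * snd h) / (1 + snd p))) / (?b * ?b) = fst (dslow c p h)" for h
  proof -
    have "fst h * ?b - fst p * (- (fst h + ?b * snd h) / (1 + snd p)) =
        ((fst p + ?b * (1 + snd p)) * fst h + fst p * ?b * snd h) / (1 + snd p)"
      using g(3) by (simp add: field_simps)
    then show ?thesis unfolding dslow_def g(6)[symmetric] by (simp add: power2_eq_square)
  qed
  moreover have "snd p * (- (fst h + ?b * snd h) / (1 + snd p)) + snd h * ?b = snd (dslow c p h)" for h
    using g(3) by (simp add: dslow_def field_simps)
  ultimately show ?thesis
    unfolding slow_def[abs_def] by simp
qed

lemma turn_has_derivative:
  assumes "p \<in> inner_dom c"
  shows "(turn c has_derivative dturn c p) (at p)"
proof -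
  note g = inner_dom_gap[OF assms]
  have a: "0 < fst p" using assms by (simp add: inner_dom_def)
  let ?b = "gap c p"
  note [derivative_intros] = gap_has_derivative[OF g(3)]
  have "((\<lambda>p. (gap c p / fst p, (1 + snd p * gap c p) / c - 1)) has_derivative
      (\<lambda>h. ((- (fst h + ?b * snd h) / (1 + snd p) * fst p - ?b * fst h) / (fst p * fst p),
        (snd p * (- (fst h + ?b * snd h) / (1 + snd p)) + snd h * ?b) / c))) (at p)"
    using g(4) a by (auto intro!: derivative_eq_intros simp: field_simps)
  moreover have "(- (fst h + ?b * snd h) / (1 + snd p) * fst p - ?b * fst h) / (fst p * fst p) = fst (dturn c p h)" for h
  proof -
    have "- (fst h + ?b * snd h) / (1 + snd p) * fst p - ?b * fst h =
        - ((fst p + ?b * (1 + snd p)) * fst h + fst p * ?b * snd h) / (1 + snd p)"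
      using g(3) by (simp add: field_simps)
    then show ?thesis unfolding dturn_def g(6)[symmetric] by (simp add: power2_eq_square)
  qed
  moreover have "(snd p * (- (fst h + ?b * snd h) / (1 + snd p)) + snd h * ?b) / c = snd (dturn c p h)" for h
    using g(3,4) by (simp add: dturn_def field_simps)
  ultimately show ?thesis
    unfolding turn_def[abs_def] by simp
qed

section \<open>Infinitely renormalizable points\<close>

definition inf_renorm :: "real \<Rightarrow> (real \<times> real) set" where
  "inf_renorm c = {p \<in> strip c. \<forall>n. heights c p n \<noteq> \<infinity>}"

lemma strip_slow:
  assumes "p \<in> inner_dom c" "fst p < c * gap c p" "p \<in> strip c"
  shows "slow c p \<in> strip c"
proof -
  note g = inner_dom_gap[OF assms(1)]
  have "slow c p \<in> param_dom c"
    using slow_inner_dom[OF assms(1,2)] inner_dom_param_dom by blast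
  moreover have "0 \<le> snd p * gap c p \<and> snd p * gap c p \<le> snd p" if "0 \<le> snd p"
    using that g by (auto intro: mult_left_le)
  moreover have "snd p * gap c p \<le> 0 \<and> snd p \<le> snd p * gap c p" if "snd p \<le> 0"
    using that g mult_left_mono_neg[of "gap c p" 1 "snd p"] by (auto intro: mult_nonpos_nonneg)
  ultimately show ?thesis
    using assms(3) unfolding strip_def slow_def by (force split: if_splits)
qed

lemma strip_turn:
  assumes "p \<in> inner_dom c" "c * gap c p < fst p" "p \<in> strip c" "c \<noteq> 1"
  shows "turn c p \<in> strip (1 / c)"
proof -
  note g = inner_dom_gap[OF assms(1)]
  have a: "0 < fst p" using assms(1) by (simp add: inner_dom_def)
  have b1: "\<bar>snd p * gap c p\<bar> \<le> \<bar>snd p\<bar>"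
    using g mult_left_le[of "gap c p" "\<bar>snd p\<bar>"] by (auto simp: abs_mult)
  \<comment> \<open>This is the amount by which \<open>a' + v'\<close> exceeds
    \<open>1 / c - 1\<close>, namely \<open>b / a + v * b / c\<close>.\<close>
  have "0 < (c + fst p * snd p) / (c / gap c p * fst p)"
    using g a by auto
  also have "\<dots> = gap c p / fst p + snd p * gap c p / c"
    using g a by (simp add: field_simps)
  finally have "0 < gap c p / fst p + snd p * gap c p / c" .
  moreover have "gap c p / fst p \<le> 1 / c" using assms(2) a g by (simp add: field_simps)
  moreover have "(1 + snd p * gap c p) / c - 1 = 1 / c + snd p * gap c p / c - 1"
    by (simp add: add_divide_distrib)
  ultimately have dom: "turn c p \<in> param_dom (1 / c)"
    using g a by (auto simp: param_dom_def turn_def)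
  show ?thesis
  proof (cases "c > 1")
    case True
    then have v: "0 \<le> snd p" "snd p \<le> c - 1" using assms(3) by (auto simp: strip_def)
    then have "0 \<le> snd p * gap c p" "snd p * gap c p \<le> c - 1"
      using b1 g by auto
    then have "1 / c - 1 \<le> (1 + snd p * gap c p) / c - 1" "(1 + snd p * gap c p) / c - 1 \<le> 0"
      using True by (simp_all add: divide_right_mono)
    then show ?thesis using dom True by (auto simp: strip_def turn_def)
  next
    case False
    then have c: "c < 1" using assms(4) by simp
    have v: "snd p \<le> 0" "c - 1 \<le> snd p" using assms(3) False by (auto simp: strip_def)
    then have "snd p * gap c p \<le> 0" "c - 1 \<le> snd p * gap c p"
      using b1 g by (auto simp: mult_nonpos_nonneg)
    then have "(1 + snd p * gap c p) / c - 1 \<le> 1 / c - 1" "0 \<le> (1 + snd p * gap c p) / c - 1"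
      using g(4) by (simp_all add: divide_right_mono)
    then show ?thesis using dom c g(4) by (auto simp: strip_def turn_def)
  qed
qed

lemma slow_times_strip:
  assumes "p \<in> slow_times k c" "p \<in> strip c" "c \<noteq> 1"
  shows "turn c ((slow c ^^ k) p) \<in> strip (1 / c)"
  using assms
proof (induction k arbitrary: p)
  case 0
  then show ?case using strip_turn by auto
next
  case (Suc k)
  then show ?case using strip_slow[of p c] by (simp add: funpow_Suc_right del: funpow.simps)
qed

lemma inf_renorm_slow_times:
  assumes "p \<in> inf_renorm c"
  obtains k where "p \<in> slow_times k c"
proof -
  have "heights c p 0 \<noteq> \<infinity>" using assms unfolding inf_renorm_def by blast
  then have "height c p \<noteq> \<infinity>" by simp
  \<comment> \<open>The second height enters because points outside the parameter domain have height
    infinity: its finiteness forces \<open>a' > 0\<close>.\<close>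
  moreover have "heights c p (Suc 0) \<noteq> \<infinity>" using assms unfolding inf_renorm_def by blast
  then have "renorm c p \<in> param_dom (1 / c)" by (auto simp: height_def split: if_splits)
  then have "fst (renorm c p) > 0" by (auto simp: param_dom_def)
  ultimately show ?thesis using finite_height_slow_times that by blast
qed

lemma inf_renorm_renorm:
  assumes "p \<in> inf_renorm c" "c \<noteq> 1"
  shows "renorm c p \<in> inf_renorm (1 / c)"
proof -
  obtain k where k: "p \<in> slow_times k c" using inf_renorm_slow_times[OF assms(1)] .
  have "heights (1 / c) (renorm c p) n \<noteq> \<infinity>" for n
  proof -
    have "heights c p (Suc n) \<noteq> \<infinity>" using assms(1) unfolding inf_renorm_def by blast
    then show ?thesis using height_slow_times[OF k] by simp
  qed
  moreover have "renorm c p \<in> strip (1 / c)"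
    unfolding renorm_slow_times[OF k] using assms
    by (intro slow_times_strip[OF k]) (auto simp: inf_renorm_def)
  ultimately show ?thesis by (simp add: inf_renorm_def)
qed

text \<open>\<open>p\<close> and \<open>slow c p\<close> have the same renormalization, so their
  height sequences differ in the first entry only.\<close>

lemma inf_renorm_slow:
  assumes "p \<in> inf_renorm c" "p \<in> slow_times (Suc k) c"
  shows "slow c p \<in> inf_renorm c"
proof -
  have s: "slow c p \<in> slow_times k c" using assms(2) by simp
  have "renorm c (slow c p) = renorm c p"
    using renorm_slow_times[OF s] renorm_slow_times[OF assms(2)] by (simp add: funpow_Suc_right del: funpow.simps)
  then have "heights c (slow c p) n \<noteq> \<infinity>" for n
  proof (cases n)
    case (Suc m)
    have "heights c p (Suc m) \<noteq> \<infinity>" using assms(1) unfolding inf_renorm_def by blast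
    with Suc \<open>renorm c (slow c p) = renorm c p\<close> show ?thesis
      using height_slow_times[OF s] height_slow_times[OF assms(2)] by simp
  qed (use height_slow_times[OF s] in simp)
  then show ?thesis
    using assms strip_slow[of p c] by (auto simp: inf_renorm_def)
qed

type_synonym state = "real \<times> real \<times> real"

definition states :: "state set" where
  "states = {(c, p). 0 < c \<and> c \<noteq> 1 \<and> p \<in> inf_renorm c}"

text \<open>
  As for the Gauss and the Farey map, one slow step at a time is easier to control than a whole
  renormalization. A state carries \<open>c\<close> because \<open>turn\<close> changes it.
\<close>

definition farey :: "state \<Rightarrow> state" where
  "farey = (\<lambda>(c, p). if fst p < c * gap c p then (c, slow c p) else (1 / c, turn c p))"

definition dfarey :: "state \<Rightarrow> real \<times> real \<Rightarrow> real \<times> real" where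
  "dfarey = (\<lambda>(c, p). if fst p < c * gap c p then dslow c p else dturn c p)"

text \<open>The tie \<open>a = c * b\<close>, which \<open>farey\<close> would treat as a turn,
  cannot occur: there \<open>F^2(-1) = 0\<close>, so the renormalized pair has
  \<open>a' = 0\<close>. Both branches are therefore strict.\<close>

lemma states_cases:
  assumes "x \<in> states"
  obtains (slow) c a v b k where "x = (c, a, v)" "b = gap c (a, v)" "0 < c" "c \<noteq> 1"
      "a < c * b" "farey x = (c, slow c (a, v))" "(a, v) \<in> slow_times (Suc k) c"
      "(a, v) \<in> inf_renorm c" "dfarey x = dslow c (a, v)"
  | (turn) c a v b where "x = (c, a, v)" "b = gap c (a, v)" "0 < c" "c \<noteq> 1"
      "c * b < a" "farey x = (1 / c, turn c (a, v))" "(a, v) \<in> slow_times 0 c"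
      "(a, v) \<in> inf_renorm c" "dfarey x = dturn c (a, v)"
proof -
  obtain c a v where x: "x = (c, a, v)" by (cases x)
  then have c: "0 < c" "c \<noteq> 1" "(a, v) \<in> inf_renorm c" using assms by (auto simp: states_def)
  obtain k where k: "(a, v) \<in> slow_times k c" using inf_renorm_slow_times[OF c(3)] .
  show thesis
  proof (cases k)
    case 0
    then show thesis using turn[OF x refl c(1,2)] c k x by (simp add: farey_def dfarey_def)
  next
    case (Suc k')
    then show thesis using slow[OF x refl c(1,2), of k'] c k x by (simp add: farey_def dfarey_def)
  qed
qed

lemma farey_states: "x \<in> states \<Longrightarrow> farey x \<in> states"
proof (erule states_cases)
  fix c a v b k assume "x = (c, a, v)" "0 < c" "c \<noteq> 1" "farey x = (c, slow c (a, v))"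
    "(a, v) \<in> slow_times (Suc k) c" "(a, v) \<in> inf_renorm c"
  then show ?thesis using inf_renorm_slow by (auto simp: states_def)
next
  fix c a v b assume "x = (c, a, v)" "0 < c" "c \<noteq> 1" "farey x = (1 / c, turn c (a, v))"
    "(a, v) \<in> slow_times 0 c" "(a, v) \<in> inf_renorm c"
  then show ?thesis
    using inf_renorm_renorm[of "(a, v)" c] renorm_slow_times[of "(a, v)" 0 c] by (auto simp: states_def)
qed

lemma state_bounds:
  assumes "(c, a, v) \<in> states" "b = gap c (a, v)"
  shows "0 < a" "a < c" "0 < b" "b < 1" "0 < 1 + v" "0 < c" "c \<noteq> 1" "c = a + b * (1 + v)"
    "0 < c + a * v" "c > 1 \<Longrightarrow> 0 \<le> v \<and> v \<le> c - 1" "c < 1 \<Longrightarrow> c - 1 \<le> v \<and> v \<le> 0"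
proof -
  have p: "(a, v) \<in> inf_renorm c" "0 < c" "c \<noteq> 1" using assms by (auto simp: states_def)
  obtain k where "(a, v) \<in> slow_times k c" using inf_renorm_slow_times[OF p(1)] .
  then have d: "(a, v) \<in> inner_dom c" using slow_times_inner_dom by blast
  then show "0 < a" "a < c" by (auto simp: inner_dom_def)
  show "0 < b" "b < 1" "0 < 1 + v" "c = a + b * (1 + v)" "0 < c + a * v"
    using inner_dom_gap[OF d] assms(2) by auto
  show "0 < c" "c \<noteq> 1" by fact+
  show "c > 1 \<Longrightarrow> 0 \<le> v \<and> v \<le> c - 1" "c < 1 \<Longrightarrow> c - 1 \<le> v \<and> v \<le> 0"
    using p(1) by (auto simp: inf_renorm_def strip_def split: if_splits)
qed

section \<open>The unstable cone\<close>

text \<open>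
  Spanning vectors of the unstable cone, normalized so that their first coordinate is \<open>a\<close>: the
  logarithmic length \<open>|da| / a\<close> never decreases along slow steps. The cone \<open>0 \<le> q \<le> 1\<close> is
  \<open>-1 \<le> dv/da \<le> 0\<close> for \<open>c > 1\<close> and \<open>0 \<le> a dv/da \<le> 1\<close> for \<open>c < 1\<close>; \<open>push\<close> is its
  image under the derivative and \<open>growth\<close> the factor gained.
\<close>

definition uvec :: "real \<Rightarrow> real \<Rightarrow> real \<Rightarrow> real \<times> real" where
  "uvec c a q = (a, if c > 1 then - (a * q) else q)"

text \<open>The part of the slope map shared by slow steps and turns; \<open>push\<close> multiplies
  it by \<open>b\<close> or by \<open>a / c\<close>.\<close>

definition push_base :: "state \<Rightarrow> real \<Rightarrow> real" where
  "push_base = (\<lambda>(c, a, v) q. let b = gap c (a, v) in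
     if c > 1 then b * (b * q + v) / (c - a * b * q) else (b * q - v * a) / (c + b * q))"

definition push :: "state \<Rightarrow> real \<Rightarrow> real" where
  "push = (\<lambda>(c, a, v) q. let b = gap c (a, v) in
     (if a < c * b then b else a / c) * push_base (c, a, v) q)"

definition growth :: "state \<Rightarrow> real \<Rightarrow> real" where
  "growth = (\<lambda>(c, a, v) q. let b = gap c (a, v) in
     (if c > 1 then c - a * b * q else c + b * q) / (c - a))"

lemma push_denominators:
  assumes "(c, a, v) \<in> states" "b = gap c (a, v)" "0 \<le> q" "q \<le> 1"
  shows "0 < c - a * b * q" "b * (1 + v) \<le> c - a * b * q" "0 < c + b * q"
proof -
  note s = state_bounds[OF assms(1,2)]
  have "b * q \<le> 1" using s(3,4) assms(3,4) by (intro mult_le_one) auto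
  then have "a * (b * q) \<le> a" using s(1,3) assms(3) by (intro mult_left_le) auto
  then show "b * (1 + v) \<le> c - a * b * q" using s(8) by simp
  moreover have "0 < b * (1 + v)" using s by simp
  ultimately show "0 < c - a * b * q" by simp
  show "0 < c + b * q" using s(3,6) assms(3) by (simp add: add_pos_nonneg)
qed

lemma push_base_range:
  assumes "(c, a, v) \<in> states" "0 \<le> q" "q \<le> 1"
  shows "push_base (c, a, v) q \<in> {0..1}"
proof -
  define b where "b = gap c (a, v)"
  note s = state_bounds[OF assms(1) b_def] and d = push_denominators[OF assms(1) b_def assms(2,3)]
  have bq: "0 \<le> b * q" "b * q \<le> b" using s assms by (auto intro: mult_left_le)
  show ?thesis
  proof (cases "c > 1")
    case True
    then have v: "0 \<le> v" using s(10) by simp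
    have "b * q \<le> 1" using bq s(4) by simp
    then have "b * (b * q + v) \<le> b * (1 + v)" using s(3) by simp
    also have "\<dots> \<le> c - a * b * q" using d by simp
    finally show ?thesis using True v bq s(3) d
      by (auto simp: push_base_def b_def[symmetric] Let_def)
  next
    case False
    then have v: "v \<le> 0" "- v \<le> 1" using s by auto
    then have "0 \<le> - v * a" "- v * a \<le> 1 * a"
      using s mult_right_mono[of "- v" 1 a] by (auto simp: mult_nonpos_nonneg)
    then show ?thesis using False bq s(2) d
      by (auto simp: push_base_def b_def[symmetric] Let_def)
  qed
qed

lemma push_range:
  assumes "x \<in> states" "0 \<le> q" "q \<le> 1"
  shows "push x q \<in> {0..1}"
proof -
  obtain c a v where x: "x = (c, a, v)" by (cases x)
  note s = state_bounds[OF assms(1)[unfolded x] refl]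
  define m where "m = (if a < c * gap c (a, v) then gap c (a, v) else a / c)"
  have "0 \<le> m" "m \<le> 1" using s by (auto simp: m_def)
  moreover have "push x q = m * push_base x q" by (simp add: push_def x m_def Let_def)
  ultimately show ?thesis
    using push_base_range[OF assms[unfolded x]] x by (auto intro: mult_le_one)
qed

text \<open>A turn reverses the sign of \<open>da\<close>. As the cones for \<open>c > 1\<close> and
  \<open>c < 1\<close> lie on opposite sides of the horizontal, the parameter \<open>q\<close> still
  keeps its order.\<close>

lemma push_mono:
  assumes "x \<in> states" "0 \<le> q" "q \<le> q'" "q' \<le> 1"
  shows "push x q \<le> push x q'"
proof -
  obtain c a v where x: "x = (c, a, v)" by (cases x)
  define b where "b = gap c (a, v)"
  note st = assms(1)[unfolded x]
  note s = state_bounds[OF st b_def]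
  note d = push_denominators[OF st b_def, of q] push_denominators[OF st b_def, of q']
  have bq: "b * q \<le> b * q'" using s assms by simp
  have "push_base x q \<le> push_base x q'"
  proof (cases "c > 1")
    case True
    have "b * (b * q + v) / (c - a * b * q) \<le> b * (b * q' + v) / (c - a * b * q')"
    proof (rule frac_le)
      show "b * (b * q + v) \<le> b * (b * q' + v)" using s bq by simp
      show "c - a * b * q' \<le> c - a * b * q" using s assms by (simp add: mult_left_mono)
      show "0 \<le> b * (b * q' + v)" using s(3,10) True assms by simp
    qed (use d assms in auto)
    then show ?thesis using True x by (simp add: push_base_def b_def[symmetric] Let_def)
  next
    case False
    then have c: "c < 1" using s by simp
    have "- v * a \<le> 1 * a" using s c by (intro mult_right_mono) auto
    then have "(c + v * a) / (c + b * q') \<le> (c + v * a) / (c + b * q)"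
      using s(2) d(3,6) bq assms(2,3,4) by (intro divide_left_mono) auto
    \<comment> \<open>Subtracting from 1 leaves the variable in the denominator only, over the
      positive constant \<open>c + v * a\<close>.\<close>
    moreover have "(b * t - v * a) / (c + b * t) = 1 - (c + v * a) / (c + b * t)"
      if "0 < c + b * t" for t
      using that by (simp add: field_simps)
    ultimately have "(b * q - v * a) / (c + b * q) \<le> (b * q' - v * a) / (c + b * q')"
      using d(3,6) assms(2,3,4) by simp
    then show ?thesis using False x by (simp add: push_base_def b_def[symmetric] Let_def)
  qed
  then show ?thesis
    using s(1,3,6) x by (simp add: push_def b_def[symmetric] Let_def mult_left_mono divide_right_mono)
qed

text \<open>As the first coordinate is normalized to \<open>a\<close>, the factor is the change of
  \<open>da / a\<close>. The new \<open>a\<close> is \<open>a / b\<close> or its inverse, so the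
  logarithmic rates agree up to sign and one \<open>growth\<close> serves both cases.\<close>

lemma dfarey_uvec:
  assumes "x \<in> states" "x = (c, a, v)" "farey x = (c', a', v')" "0 \<le> q" "q \<le> 1"
  shows "dfarey x (uvec c a q) =
    (if a < c * gap c (a, v) then growth x q else - growth x q) *\<^sub>R uvec c' a' (push x q)"
proof -
  define b where "b = gap c (a, v)"
  define w where "w = 1 + v"
  define D where "D = (if c > 1 then c - a * b * q else c + b * q)"
  define N where "N = b * snd (uvec c a q) - v * a"
  note st = assms(1)[unfolded assms(2)]
  note s = state_bounds[OF st b_def] and d = push_denominators[OF st b_def assms(4,5)]
  have nz: "a \<noteq> 0" "b \<noteq> 0" "w \<noteq> 0" "c \<noteq> 0" "D \<noteq> 0"
    using s(1,3,5,6) d by (auto simp: w_def D_def)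
  have fst_u: "fst (uvec c a q) = a" by (simp add: uvec_def)
  have num: "c * a + a * b * snd (uvec c a q) = a * D"
    by (simp add: uvec_def D_def algebra_simps)
  have gr: "growth x q = D / (b * w)"
  proof -
    have "c - a = b * w" using s(8) by (simp add: w_def)
    then show ?thesis using assms(2) by (simp add: growth_def D_def b_def[symmetric] Let_def)
  qed
  have base: "push_base x q = (if c > 1 then - (b * N) / (a * D) else N / D)"
  proof (cases "c > 1")
    case True
    then have "N = - a * (b * q + v)" by (simp add: N_def uvec_def algebra_simps)
    then show ?thesis
      using True nz assms(2) by (simp add: push_base_def D_def b_def[symmetric] Let_def)
  qed (use assms(2) in \<open>simp add: push_base_def D_def N_def uvec_def b_def[symmetric] Let_def\<close>)
  have push: "push x q = (if a < c * b then b else a / c) * push_base x q"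
    using assms(2) by (simp add: push_def b_def Let_def)
  show ?thesis
  proof (cases "a < c * b")
    case True
    have "dfarey x (uvec c a q) = (a * D / (w * b\<^sup>2), N / w)"
      using True num fst_u assms(2)
      by (simp add: dfarey_def dslow_def w_def N_def b_def[symmetric])
    moreover have "c' = c" "a' = a / b"
      using True assms(2,3) by (auto simp: farey_def slow_def b_def)
    ultimately show ?thesis
      using True nz unfolding gr push base b_def[symmetric]
      by (simp add: uvec_def power2_eq_square mult_ac)
  next
    case False
    have "dfarey x (uvec c a q) = (- (a * D) / (w * a\<^sup>2), N / (w * c))"
      using False num fst_u assms(2)
      by (simp add: dfarey_def dturn_def w_def N_def b_def[symmetric])
    moreover have "c' = 1 / c" "a' = b / a"
      using False assms(2,3) by (auto simp: farey_def turn_def b_def)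
    moreover have "1 / c > 1 \<longleftrightarrow> \<not> c > 1"
      using s(6,7) by auto
    ultimately show ?thesis
      using False nz unfolding gr push base b_def[symmetric]
      by (simp add: uvec_def power2_eq_square mult_ac)
  qed
qed

lemma growth_ge_one:
  assumes "x \<in> states" "0 \<le> q" "q \<le> 1"
  shows "1 \<le> growth x q"
proof -
  obtain c a v where x: "x = (c, a, v)" by (cases x)
  define b where "b = gap c (a, v)"
  note s = state_bounds[OF assms(1)[unfolded x] b_def]
    and d = push_denominators[OF assms(1)[unfolded x] b_def assms(2,3)]
  have "b * (1 + v) = c - a" using s(8) by simp
  moreover have "0 \<le> b * q" using s assms by simp
  ultimately show ?thesis
    using s(1,2) d by (auto simp: growth_def x b_def[symmetric] Let_def)
qed

lemma gap_turn_bound: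
  assumes "(c, a, v) \<in> states" "b = gap c (a, v)" "c * b < a" "c > 1"
  shows "b < c / (1 + c)"
proof -
  note s = state_bounds[OF assms(1,2)]
  have "b * 1 \<le> b * (1 + v)" using s assms(4) by (intro mult_left_mono) auto
  then have "b + c * b < c" using s(8) assms(3) by simp
  then show ?thesis using s(6) by (simp add: field_simps)
qed

text \<open>The second bound concerns the growth times the new \<open>a\<close>, which is
  \<open>b / a\<close>. The new \<open>a\<close> may be tiny, but then \<open>b\<close> is small and
  the growth, which has \<open>c - a = b * (1 + v)\<close> in its denominator, is large
  accordingly.\<close>

lemma growth_turn:
  assumes "(c, a, v) \<in> states" "c * gap c (a, v) < a" "0 \<le> q" "q \<le> 1" "c \<le> C" "1 / c \<le> C"
  shows "1 + 1 / (1 + C) \<le> growth (c, a, v) q"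
    and "1 / (C * (1 + C)) \<le> growth (c, a, v) q * (gap c (a, v) / a)"
proof -
  define b where "b = gap c (a, v)"
  note s = state_bounds[OF assms(1) b_def]
    and d = push_denominators[OF assms(1) b_def assms(3,4)]
  have lt: "c * b < a" using assms(2) b_def by simp
  have ca: "c - a = b * (1 + v)" using s(8) by simp
  have bq: "0 \<le> b * q" "b * q \<le> b" using s(3) assms by (auto intro: mult_left_le)
  have C: "1 < C" 
  proof (cases "c > 1")
    case False
    then have "1 < 1 / c" using s(6,7) by simp
    then show ?thesis using assms(6) by simp
  qed (use assms(5) in simp)
  have "1 + 1 / (1 + C) \<le> growth (c, a, v) q \<and>
      1 / (C * (1 + C)) \<le> growth (c, a, v) q * (b / a)"
  proof (cases "c > 1")
    case True
    have v: "0 \<le> v" "1 + v \<le> c" using s(10) True by auto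
    have "1 - b * q \<ge> 1 - c / (1 + c)" using gap_turn_bound[OF assms(1) b_def lt True] bq by simp
    also have "1 - c / (1 + c) = 1 / (1 + c)" using s(6) by (simp add: field_simps)
    also have "\<dots> \<ge> 1 / (1 + C)" using assms(5) s(6) by (simp add: frac_le)
    finally have bq1: "1 / (1 + C) \<le> 1 - b * q" .
    have "c - a \<le> b * c" using ca v s(3) by simp
    then have "c - a \<le> a" using lt by (simp add: mult.commute)
    then have r: "1 \<le> a / (c - a)" using s(2) by simp
    have gr: "growth (c, a, v) q = (c - a * b * q) / (c - a)"
      using True by (simp add: growth_def b_def Let_def)
    \<comment> \<open>At a turn with \<open>c > 1\<close>, \<open>c - a \<le> b * c < a\<close>
      makes the quotient at least 1, and \<open>gap_turn_bound\<close> keeps \<open>b * q\<close>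
      away from 1.\<close>
    also have "\<dots> = 1 + (a / (c - a)) * (1 - b * q)"
      using s(2) by (simp add: field_simps)
    also have "\<dots> \<ge> 1 + 1 * (1 / (1 + C))"
      using r bq1 C by (intro add_left_mono mult_mono) auto
    finally have 1: "1 + 1 / (1 + C) \<le> growth (c, a, v) q" by simp
    have "a * (1 - b * q) \<le> c - a * b * q" using s(2) by (simp add: algebra_simps)
    then have "(a * (1 - b * q)) / (a * (1 + v)) \<le> (c - a * b * q) / (a * (1 + v))"
      using s(1,5) by (intro divide_right_mono) auto
    moreover have "(1 / (1 + C)) / C \<le> (1 - b * q) / (1 + v)"
      using bq1 bq s(4) v assms(5) C by (intro frac_le) auto
    moreover have "growth (c, a, v) q * (b / a) = (c - a * b * q) / (a * (1 + v))"
      unfolding gr ca using s(3) by simp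
    ultimately show ?thesis using 1 s(1) by (simp add: mult.commute)
  next
    case False
    then have c: "c < 1" using s(7) by simp
    have v: "v \<le> 0" using s(11) c by auto
    have gr: "growth (c, a, v) q = (c + b * q) / (c - a)"
      using False by (simp add: growth_def b_def Let_def)
    have "1 / C \<le> c" using assms(6) s(6) C by (simp add: field_simps)
    moreover have "1 / (1 + C) \<le> 1 / C" using C by (simp add: frac_le)
    ultimately have c1: "1 / (1 + C) \<le> c" by simp
    have "c - a \<le> b" using ca v s(3) by (simp add: mult_left_le)
    then have "c * (c - a) \<le> c * b" using s(6) by simp
    then have "(1 + c) * (c - a) \<le> c" using lt by (simp add: algebra_simps)
    \<comment> \<open>For \<open>c < 1\<close> the gain is at least \<open>c\<close> itself, and
      \<open>c\<close> is at least \<open>1 / C\<close>.\<close>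
    then have "1 + c \<le> c / (c - a)" using s(2) by (simp add: le_divide_eq)
    also have "\<dots> \<le> growth (c, a, v) q"
      unfolding gr using s(2) bq by (intro divide_right_mono) auto
    finally have 1: "1 + 1 / (1 + C) \<le> growth (c, a, v) q" using c1 by simp
    have "growth (c, a, v) q * (b / a) = (c + b * q) / (a * (1 + v))"
      unfolding gr ca using s(3) by simp
    moreover have "1 \<le> (c + b * q) / (a * (1 + v))"
    proof -
      have "a * (1 + v) \<le> a" using s(1) v by (simp add: mult_left_le)
      then have "a * (1 + v) \<le> c + b * q" using s(2) bq(1) by linarith
      then show ?thesis using s(1,5) by (simp add: le_divide_eq)
    qed
    moreover have "1 / (C * (1 + C)) \<le> 1"
      using C mult_mono[of 1 C 1 "1 + C"] by (simp add: divide_le_eq_1)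
    ultimately show ?thesis using 1 by simp
  qed
  then show "1 + 1 / (1 + C) \<le> growth (c, a, v) q"
    "1 / (C * (1 + C)) \<le> growth (c, a, v) q * (gap c (a, v) / a)"
    by (auto simp: b_def)
qed

section \<open>The stable cone\<close>

text \<open>
  The stable cone is spanned by \<open>wvec k\<close>, \<open>0 \<le> k \<le> b\<close>, and \<open>pull\<close> is its preimage. A turn
  reverses the order of slopes, so the cone is parametrized in opposite directions for \<open>c > 1\<close> and
  \<open>c < 1\<close>; this makes \<open>pull\<close> increasing.
\<close>

definition orient :: "real \<Rightarrow> real \<Rightarrow> real" where
  "orient c t = (if c > 1 then t else 1 - t)"

definition tilt :: "state \<Rightarrow> real \<Rightarrow> real" where
  "tilt = (\<lambda>(c, p) t. gap c p * orient c t)"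

definition wvec :: "real \<Rightarrow> real \<times> real" where
  "wvec k = (- k, 1)"

definition pull :: "state \<Rightarrow> real \<Rightarrow> real" where
  "pull = (\<lambda>(c, a, v) t. let b = gap c (a, v); k = tilt (farey (c, a, v)) t in
     orient c (if a < c * b then (a + b\<^sup>2 * k) / (c - v * b\<^sup>2 * k)
       else a * (c - a * k) / (c\<^sup>2 + v * a\<^sup>2 * k)))"

lemma orient_orient [simp]: "orient c (orient c t) = t"
  by (simp add: orient_def)

lemma orient_range: "orient c t \<in> {0..1} \<longleftrightarrow> t \<in> {0..1}"
  by (auto simp: orient_def)

lemma tilt_range:
  assumes "x \<in> states" "0 \<le> t" "t \<le> 1"
  shows "0 \<le> tilt x t" "tilt x t \<le> 1" "\<And>c a v. x = (c, a, v) \<Longrightarrow> tilt x t \<le> gap c (a, v)"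
proof -
  obtain c a v where x: "x = (c, a, v)" by (cases x)
  note s = state_bounds[OF assms(1)[unfolded x] refl]
  have o: "0 \<le> orient c t" "orient c t \<le> 1" using assms by (auto simp: orient_def)
  show "0 \<le> tilt x t" "tilt x t \<le> 1"
    using o s(3,4) x by (auto simp: tilt_def mult_le_one)
  show "tilt x t \<le> gap c (a, v)" if "x = (c, a, v)" for c a v
    using that o s(3) x by (auto simp: tilt_def mult_left_le)
qed

lemma pull_denominators:
  assumes "(c, a, v) \<in> states" "b = gap c (a, v)" "0 \<le> k" "k \<le> 1"
  shows "0 < c - v * b\<^sup>2 * k" "0 < c\<^sup>2 + v * a\<^sup>2 * k"
    "a + b\<^sup>2 * k \<le> c - v * b\<^sup>2 * k" "0 \<le> a * (c - a * k)"
    "a * (c - a * k) \<le> c\<^sup>2 + v * a\<^sup>2 * k"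
proof -
  note s = state_bounds[OF assms(1,2)]
  have "b * (b * k) \<le> b * 1"
    using s(3,4) assms(3,4) by (intro mult_left_mono mult_le_one) auto
  then have "(1 + v) * (b\<^sup>2 * k) \<le> (1 + v) * b"
    using s(5) by (intro mult_left_mono) (auto simp: power2_eq_square mult.assoc)
  then show 1: "a + b\<^sup>2 * k \<le> c - v * b\<^sup>2 * k"
    using s(8) by (simp add: algebra_simps)
  show "0 < c - v * b\<^sup>2 * k"
    by (rule less_le_trans[OF _ 1]) (use s(1,3) assms(3) in \<open>simp add: add_pos_nonneg\<close>)
  have ak: "a * k \<le> a" using s(1) assms(4) by (intro mult_left_le) auto
  then have "0 \<le> c - a * k" using s(2) by linarith
  then show nn: "0 \<le> a * (c - a * k)" using s(1) by (intro mult_nonneg_nonneg) auto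
  have "a * c \<le> c\<^sup>2" using s(2,6) by (simp add: power2_eq_square)
  moreover have "0 \<le> (1 + v) * (a\<^sup>2 * k)" using s(5) assms(3) by simp
  ultimately show "a * (c - a * k) \<le> c\<^sup>2 + v * a\<^sup>2 * k"
    by (simp add: algebra_simps power2_eq_square)
  have "a * c < c\<^sup>2" using s(2,6) by (simp add: power2_eq_square)
  with \<open>0 \<le> (1 + v) * (a\<^sup>2 * k)\<close> have "a * (c - a * k) < c\<^sup>2 + v * a\<^sup>2 * k"
    by (simp add: algebra_simps power2_eq_square)
  then show "0 < c\<^sup>2 + v * a\<^sup>2 * k" using nn by simp
qed

lemma pull_range:
  assumes "x \<in> states" "0 \<le> t" "t \<le> 1"
  shows "pull x t \<in> {0..1}"
proof -
  obtain c a v where x: "x = (c, a, v)" by (cases x)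
  note st = assms(1)[unfolded x]
  define k where "k = tilt (farey (c, a, v)) t"
  have k: "0 \<le> k" "k \<le> 1" using tilt_range[OF farey_states[OF st] assms(2,3)] by (auto simp: k_def)
  note s = state_bounds[OF st refl] and d = pull_denominators[OF st refl k]
  have "0 \<le> a + (gap c (a, v))\<^sup>2 * k" using s(1) k by simp
  then show ?thesis
    using d unfolding x pull_def Let_def prod.case orient_range k_def[symmetric]
    by (auto simp: divide_le_eq_1)
qed

text \<open>Cross-multiplying leaves \<open>(c + a * v) * b^2 * (k' - k)\<close>. The sign of
  \<open>c + a * v\<close>, hence that \<open>F\<close> increases, gives the monotonicity here and
  for turns.\<close>

lemma slow_pull_mono:
  fixes a b c v :: real
  assumes "k \<le> k'" "0 < c - v * b\<^sup>2 * k" "0 < c - v * b\<^sup>2 * k'" "0 \<le> c + a * v"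
  shows "(a + b\<^sup>2 * k) / (c - v * b\<^sup>2 * k) \<le> (a + b\<^sup>2 * k') / (c - v * b\<^sup>2 * k')"
proof -
  have "0 \<le> (c + a * v) * (b\<^sup>2 * (k' - k))" using assms by simp
  also have "\<dots> = (a + b\<^sup>2 * k') * (c - v * b\<^sup>2 * k) - (a + b\<^sup>2 * k) * (c - v * b\<^sup>2 * k')"
    by (simp add: algebra_simps)
  finally show ?thesis
    unfolding pos_divide_le_eq[OF assms(2)] times_divide_eq_left pos_le_divide_eq[OF assms(3)] by simp
qed

lemma turn_pull_antimono:
  fixes a c v :: real
  assumes "k \<le> k'" "0 < c\<^sup>2 + v * a\<^sup>2 * k" "0 < c\<^sup>2 + v * a\<^sup>2 * k'" "0 \<le> c" "0 \<le> c + a * v"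
  shows "a * (c - a * k') / (c\<^sup>2 + v * a\<^sup>2 * k') \<le> a * (c - a * k) / (c\<^sup>2 + v * a\<^sup>2 * k)"
proof -
  have "0 \<le> c * (c + a * v) * (a\<^sup>2 * (k' - k))" using assms by simp
  also have "\<dots> = a * (c - a * k) * (c\<^sup>2 + v * a\<^sup>2 * k') - a * (c - a * k') * (c\<^sup>2 + v * a\<^sup>2 * k)"
    by (simp add: algebra_simps power2_eq_square)
  finally show ?thesis
    unfolding pos_divide_le_eq[OF assms(3)] times_divide_eq_left pos_le_divide_eq[OF assms(2)] by simp
qed

lemma pull_mono:
  assumes "x \<in> states" "0 \<le> t" "t \<le> t'" "t' \<le> 1"
  shows "pull x t \<le> pull x t'"
proof -
  obtain c a v where x: "x = (c, a, v)" by (cases x)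
  note st = assms(1)[unfolded x]
  note s = state_bounds[OF st refl]
  define k k' where "k = tilt (farey x) t" and "k' = tilt (farey x) t'"
  have k: "0 \<le> k" "k \<le> 1" and k': "0 \<le> k'" "k' \<le> 1"
    using tilt_range[OF farey_states[OF assms(1)]] assms by (auto simp: k_def k'_def)
  note d = pull_denominators[OF st refl k] pull_denominators[OF st refl k']
  obtain c1 a1 v1 where fx: "farey x = (c1, a1, v1)" by (cases "farey x")
  have b1: "0 \<le> gap c1 (a1, v1)"
    using state_bounds(3)[OF farey_states[OF assms(1), unfolded fx] refl] by simp
  \<comment> \<open>A turn flips the orientation used at the image and also reverses the slopes, and
    the two reversals cancel.\<close>
  have t: "if c1 > 1 then k \<le> k' else k' \<le> k"
    using b1 assms(3) by (auto simp: k_def k'_def fx tilt_def orient_def mult_left_mono)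
  have cc: "1 / c > 1 \<longleftrightarrow> \<not> c > 1" using s(6,7) by auto
  have c1: "c1 = (if a < c * gap c (a, v) then c else 1 / c)"
    using fx x by (auto simp: farey_def split: if_splits)
  show ?thesis
    using t cc s(6,9) d
    unfolding x pull_def Let_def prod.case k_def[symmetric, unfolded x] k'_def[symmetric, unfolded x] c1
    by (auto simp: orient_def intro!: slow_pull_mono turn_pull_antimono split: if_splits)
qed

text \<open>The second coordinate of \<open>dslow\<close> or \<open>dturn\<close> at
  \<open>(-k, 1)\<close>, hence the factor by which \<open>dv\<close> changes.\<close>

definition contraction :: "state \<Rightarrow> real \<Rightarrow> real" where
  "contraction = (\<lambda>(c, a, v) k. let b = gap c (a, v) in
     (b + v * k) / (if a < c * b then 1 + v else (1 + v) * c))"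

lemma dfarey_wvec:
  assumes "x \<in> states" "0 \<le> t" "t \<le> 1"
  shows "dfarey x (wvec (tilt x (pull x t))) =
    contraction x (tilt x (pull x t)) *\<^sub>R wvec (tilt (farey x) t)"
proof -
  obtain c a v where x: "x = (c, a, v)" by (cases x)
  note st = assms(1)[unfolded x]
  define b where "b = gap c (a, v)"
  define w where "w = 1 + v"
  note s = state_bounds[OF st b_def]
  define k where "k = tilt (farey x) t"
  have k: "0 \<le> k" "k \<le> 1"
    using tilt_range[OF farey_states[OF assms(1)]] assms by (auto simp: k_def)
  note d = pull_denominators[OF st b_def k]
  have nz: "a \<noteq> 0" "b \<noteq> 0" "w \<noteq> 0" "c \<noteq> 0" using s by (auto simp: w_def)
  define K where "K = tilt x (pull x t)"
  have K: "K = b * (if a < c * b then (a + b\<^sup>2 * k) / (c - v * b\<^sup>2 * k)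
       else a * (c - a * k) / (c\<^sup>2 + v * a\<^sup>2 * k))"
    unfolding K_def x tilt_def pull_def Let_def prod.case orient_orient b_def k_def by simp
  have goal: "dfarey x (wvec K) = contraction x K *\<^sub>R wvec k"
  proof (cases "a < c * b")
    case True
    define D where "D = c - v * b\<^sup>2 * k"
    have K: "K * D = b * (a + b\<^sup>2 * k)" using True d by (simp add: K D_def)
    have D: "D \<noteq> 0" using d by (simp add: D_def)
    have "(a * b - c * K) * D = - k * b\<^sup>2 * (b + v * K) * D"
    proof -
      have "(a * b - c * K) * D = a * b * D - c * (K * D)" by (simp add: algebra_simps)
      also have "\<dots> = - k * b\<^sup>2 * (b * D + v * (K * D))"
        unfolding K by (simp add: D_def power2_eq_square algebra_simps)
      finally show ?thesis by (simp add: algebra_simps)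
    qed
    \<comment> \<open>This equation says that the image of \<open>wvec K\<close> is parallel to
      \<open>wvec k\<close>; solving it for \<open>K\<close> gives the formula in
      \<open>pull\<close>. The turn below is analogous.\<close>
    then have "a * b - c * K = - k * b\<^sup>2 * (b + v * K)" by (rule mult_right_cancel[OF D, THEN iffD1])
    then show ?thesis
      using True nz by (simp add: x dfarey_def dslow_def wvec_def contraction_def
        b_def[symmetric] w_def[symmetric] Let_def mult_ac)
  next
    case False
    define D where "D = c\<^sup>2 + v * a\<^sup>2 * k"
    have K: "K * D = b * (a * (c - a * k))" using False d by (simp add: K D_def)
    have D: "D \<noteq> 0" using d by (simp add: D_def)
    have "(c * (c * K - a * b)) * D = - k * a\<^sup>2 * (b + v * K) * D"
    proof -
      have "(c * (c * K - a * b)) * D = c * c * (K * D) - c * a * b * D" by (simp add: algebra_simps)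
      also have "\<dots> = - k * a\<^sup>2 * (b * D + v * (K * D))"
        unfolding K by (simp add: D_def power2_eq_square algebra_simps)
      finally show ?thesis by (simp add: algebra_simps)
    qed
    then have "c * (c * K - a * b) = - k * a\<^sup>2 * (b + v * K)" by (rule mult_right_cancel[OF D, THEN iffD1])
    then have "c * K - a * b = - k * a\<^sup>2 * (b + v * K) / c" using nz by (simp add: field_simps)
    then show ?thesis
      using False nz by (simp add: x dfarey_def dturn_def wvec_def contraction_def
        b_def[symmetric] w_def[symmetric] Let_def mult_ac)
  qed
  then show ?thesis by (simp add: K_def k_def)
qed

section \<open>Collisions of the Farey map\<close>

text \<open>
  The Farey map is not injective, because the height can be forgotten: \<open>p\<close> and \<open>slow c p\<close> have the
  same renormalization. Two states collide only as a slow step and a turn that both start on the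
  boundary of the strip, and there the tangent of the boundary has the same image for both.
\<close>

definition strip_boundary :: "state set" where
  "strip_boundary = {(c, a, v). v = 0 \<or> v = c - 1}"

text \<open>From \<open>A = a / b\<close> and \<open>V = v * b\<close> one recovers \<open>b\<close>
  by \<open>b * (1 + A) = a + b = c - V\<close>.\<close>

lemma slow_injective:
  assumes "(c, a, v) \<in> states" "(c, a2, v2) \<in> states" "b = gap c (a, v)" "b2 = gap c (a2, v2)"
    "a / b = a2 / b2" "v * b = v2 * b2"
  shows "a = a2 \<and> v = v2"
proof -
  note s = state_bounds[OF assms(1,3)] and s2 = state_bounds[OF assms(2,4)]
  have "b * (1 + a / b) = c - v * b" using s(3,8) by (simp add: algebra_simps)
  moreover have "b2 * (1 + a2 / b2) = c - v2 * b2" using s2(3,8) by (simp add: algebra_simps)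
  ultimately have "b * (1 + a / b) = b2 * (1 + a / b)" using assms(5,6) by simp
  moreover have "1 + a / b \<noteq> 0" using s(1,3) by (smt (verit) divide_pos_pos)
  ultimately have "b = b2" by simp
  then show ?thesis using assms(5,6) s(3) by simp
qed

text \<open>In the image coordinates \<open>A = a / b\<close>, \<open>V = v * b\<close>, the images
  of the two strips lie on opposite sides of the curve \<open>V * (A + c) = c * (c - 1)\<close>.
  They can meet only on it, and it is the image of the boundary lines \<open>v = c - 1\<close> and
  \<open>v2 = 1 / c - 1\<close>.\<close>

lemma slow_turn_collision:
  assumes "(c, a, v) \<in> states" "(1 / c, a2, v2) \<in> states"
    and b: "b = gap c (a, v)" and b2: "b2 = gap (1 / c) (a2, v2)"
    and eq1: "a / b = b2 / a2" and eq2: "v * b = (1 + v2 * b2) / (1 / c) - 1"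
  shows "v = c - 1" "v2 = 1 / c - 1" "a2 = b / c" "b2 = a / c"
proof -
  define \<gamma> where "\<gamma> = 1 / c"
  note s = state_bounds[OF assms(1) b]
    and s2 = state_bounds[OF assms(2) b2, folded \<gamma>_def]
  have c\<gamma>: "c = 1 / \<gamma>" "c * \<gamma> = 1" using s(6) by (auto simp: \<gamma>_def)
  \<comment> \<open>\<open>W1\<close> reads the sign of \<open>W\<close> off the slow preimage and
    \<open>W2\<close> off the turn preimage; the strip conditions make these signs opposite.\<close>
  define W where "W = v * b * (a / b + c) - c * (c - 1)"
  have W1: "W * (1 + v) = (v - (c - 1)) * (c + a * v)"
  proof -
    have "W * (1 + v) = v * a * (1 + v) + c * v * (b * (1 + v)) - c * (c - 1) * (1 + v)"
      using s(3) by (simp add: W_def algebra_simps)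
    also have "b * (1 + v) = c - a" using s(8) by simp
    finally show ?thesis by (simp add: algebra_simps)
  qed
  have W2: "W * (\<gamma>\<^sup>2 * a2 * (1 + v2)) = b2 * ((v2 - (\<gamma> - 1)) * (\<gamma> + a2 * v2))"
  proof -
    have "W * (\<gamma>\<^sup>2 * a2) = b2 * ((1 - \<gamma>) * \<gamma> + v2 * (a2 + \<gamma> * b2))"
      unfolding W_def eq1 eq2 \<gamma>_def[symmetric] using s2(1,6) unfolding c\<gamma>(1)
      by (simp add: field_simps power2_eq_square)
    then have "W * (\<gamma>\<^sup>2 * a2) * (1 + v2) = b2 * ((1 - \<gamma>) * \<gamma> + v2 * (a2 + \<gamma> * b2)) * (1 + v2)"
      by simp
    also have "\<dots> = b2 * ((1 - \<gamma>) * \<gamma> * (1 + v2) + v2 * a2 * (1 + v2) + v2 * \<gamma> * (b2 * (1 + v2)))"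
      by (simp add: algebra_simps)
    also have "b2 * (1 + v2) = \<gamma> - a2" using s2(8) by simp
    finally show ?thesis by (simp add: algebra_simps)
  qed
  have pos: "0 < \<gamma>\<^sup>2 * a2 * (1 + v2)" using s2(1,5,6) by simp
  have "W = 0"
  proof (cases "c > 1")
    case True
    then have "\<gamma> < 1" by (simp add: \<gamma>_def)
    have "W * (1 + v) \<le> 0"
      unfolding W1 using s(9,10) True by (intro mult_nonpos_nonneg) auto
    then have "W \<le> 0" using s(5) by (simp add: mult_le_0_iff)
    moreover
    have "0 \<le> W * (\<gamma>\<^sup>2 * a2 * (1 + v2))"
      unfolding W2 using s2(3,9,11) \<open>\<gamma> < 1\<close> by (intro mult_nonneg_nonneg) auto
    then have "0 \<le> W" using pos mult_le_cancel_right_pos[of "\<gamma>\<^sup>2 * a2 * (1 + v2)" 0 W] by simp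
    ultimately show ?thesis by simp
  next
    case False
    then have "c < 1" "\<gamma> > 1" using s(6,7) by (auto simp: \<gamma>_def)
    have "0 \<le> W * (1 + v)"
      unfolding W1 using s(9,11) \<open>c < 1\<close> by (intro mult_nonneg_nonneg) auto
    then have "0 \<le> W" using s(5) by (simp add: zero_le_mult_iff)
    moreover
    have "W * (\<gamma>\<^sup>2 * a2 * (1 + v2)) \<le> 0"
      unfolding W2 using s2(3,9,10) \<open>\<gamma> > 1\<close> by (intro mult_nonneg_nonpos mult_nonpos_nonneg) auto
    then have "W \<le> 0" using pos mult_le_cancel_right_pos[of "\<gamma>\<^sup>2 * a2 * (1 + v2)" W 0] by simp
    ultimately show ?thesis by simp
  qed
  then show v: "v = c - 1" and v2: "v2 = 1 / c - 1"
    using W1 W2 s(9) s2(3,9) by (auto simp: \<gamma>_def)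
  have "1 + v2 = \<gamma>" using v2 by (simp add: \<gamma>_def)
  then have "b2 * \<gamma> = \<gamma> - a2" using s2(8) by simp
  then have "b2 * \<gamma> * c = (\<gamma> - a2) * c" by simp
  then have "b2 * (c * \<gamma>) = c * \<gamma> - a2 * c" by (simp add: algebra_simps)
  then have b2_eq: "b2 = 1 - a2 * c" by (simp add: c\<gamma>(2))
  have a_eq: "a = c - b * c" using s(8) v by simp
  have "a * a2 = b * b2" using eq1 s(3) s2(1) by (simp add: frac_eq_eq)
  then have "(c - b * c) * a2 = b * (1 - a2 * c)" unfolding b2_eq a_eq .
  then have b_eq: "b = a2 * c" by (simp add: algebra_simps)
  show "a2 = b / c" using b_eq s(6) by simp
  show "b2 = a / c" unfolding b2_eq a_eq b_eq[symmetric] using s(6) by (simp add: diff_divide_distrib)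
qed

lemma push_collision:
  assumes "(c, a, v) \<in> states" "(1 / c, a2, v2) \<in> states"
    and b: "b = gap c (a, v)" and b2: "b2 = gap (1 / c) (a2, v2)"
    and eq: "a / b = b2 / a2" "v * b = (1 + v2 * b2) / (1 / c) - 1"
    and br: "a < c * b" "1 / c * b2 < a2"
  shows "push (c, a, v) 0 = push (1 / c, a2, v2) 0"
proof -
  note s = state_bounds[OF assms(1) b]
  note e = slow_turn_collision[OF assms(1-6)]
  have p1: "push (c, a, v) 0 = b * (if c > 1 then b * (c - 1) / c else (1 - c) * a / c)"
    using br(1) e(1) by (auto simp: push_def push_base_def b[symmetric] Let_def algebra_simps)
  have "\<not> a2 < 1 / c * b2" using br(2) by simp
  then have "push (1 / c, a2, v2) 0 = a2 / (1 / c) *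
      (if 1 / c > 1 then b2 * v2 / (1 / c) else - v2 * a2 / (1 / c))"
    by (simp add: push_def push_base_def b2[symmetric] Let_def)
  also have "\<dots> = b * (if c > 1 then b * (c - 1) / c else (1 - c) * a / c)"
    using s(6,7) unfolding e by (auto simp: field_simps)
  finally show ?thesis using p1 by simp
qed

lemma farey_collision:
  assumes "x \<in> states" "y \<in> states" "farey x = farey y"
  shows "x = y \<or> x \<in> strip_boundary \<and> y \<in> strip_boundary \<and> push x 0 = push y 0"
proof -
  have mixed: "x \<in> strip_boundary \<and> y \<in> strip_boundary \<and> push x 0 = push y 0"
    if st: "x \<in> states" "y \<in> states" and x: "x = (c, a, v)" and y: "y = (c2, a2, v2)"
      and f: "(c, slow c (a, v)) = (1 / c2, turn c2 (a2, v2))"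
      and br: "a < c * gap c (a, v)" "c2 * gap c2 (a2, v2) < a2" and c2: "0 < c2"
    for x y c a v c2 a2 v2
  proof -
    have c2: "c2 = 1 / c" using f c2 by auto
    have eq: "a / gap c (a, v) = gap (1 / c) (a2, v2) / a2"
      "v * gap c (a, v) = (1 + v2 * gap (1 / c) (a2, v2)) / (1 / c) - 1"
      using f unfolding c2 by (simp_all add: slow_def turn_def)
    note h = st(1)[unfolded x] st(2)[unfolded y c2] refl refl eq
    show ?thesis
      using slow_turn_collision(1,2)[OF h] push_collision[OF h br[unfolded c2]]
      unfolding x y c2 by (simp add: strip_boundary_def)
  qed
  from assms(1) show ?thesis
  proof (cases rule: states_cases)
    case X: (slow c a v b k)
    from assms(2) show ?thesis
    proof (cases rule: states_cases)
      case Y: (slow c2 a2 v2 b2 k2)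
      have "c2 = c" and e: "a / b = a2 / b2" "v * b = v2 * b2"
        using assms(3) X Y by (auto simp: slow_def)
      then show ?thesis using slow_injective[of c a v a2 v2 b b2] X Y assms(1,2) by simp
    next
      case Y: (turn c2 a2 v2 b2)
      have f: "(c, slow c (a, v)) = (1 / c2, turn c2 (a2, v2))"
        unfolding X(6)[symmetric] Y(6)[symmetric] by (rule assms(3))
      show ?thesis
        by (rule disjI2) (rule mixed[OF assms(1,2) X(1) Y(1) f X(5)[unfolded X(2)] Y(5)[unfolded Y(2)] Y(3)])
    qed
  next
    case X: (turn c a v b)
    from assms(2) show ?thesis
    proof (cases rule: states_cases)
      case Y: (slow c2 a2 v2 b2 k2)
      have f: "(c2, slow c2 (a2, v2)) = (1 / c, turn c (a, v))"
        unfolding X(6)[symmetric] Y(6)[symmetric] by (rule assms(3)[symmetric])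
      show ?thesis
        using mixed[OF assms(2,1) Y(1) X(1) f Y(5)[unfolded Y(2)] X(5)[unfolded X(2)] X(3)]
        by (intro disjI2) (elim conjE, intro conjI, auto)
    next
      case Y: (turn c2 a2 v2 b2)
      have c: "c2 = c" and e: "b / a = b2 / a2" "(1 + v * b) / c = (1 + v2 * b2) / c"
        using assms(3) X Y by (auto simp: turn_def)
      \<comment> \<open>Undoing the inversion and the affine map that distinguish
        \<open>turn\<close> from \<open>slow\<close> reduces two turns to two slow steps.\<close>
      have "a / b = a2 / b2" using arg_cong[OF e(1), of inverse] by simp
      moreover have "v * b = v2 * b2" using e(2) X(3) by simp
      ultimately show ?thesis using slow_injective[of c a v a2 v2 b b2] X Y c assms(1,2) by simp
    qed
  qed
qed

text \<open>As \<open>b < 1\<close>, \<open>|v * b| < |v| \<le> |c - 1|\<close> unless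
  \<open>v = 0\<close>. So the boundary is reached only from the line \<open>v = 0\<close>, whose
  horizontal direction \<open>q = 0\<close> stays horizontal.\<close>

lemma farey_boundary:
  assumes "x \<in> states" "farey x \<in> strip_boundary"
  shows "x \<in> strip_boundary \<and> push x 0 = 0"
proof -
  obtain c a v where x: "x = (c, a, v)" by (cases x)
  define b where "b = gap c (a, v)"
  note s = state_bounds[OF assms(1)[unfolded x] b_def]
  have "\<bar>v * b\<bar> < \<bar>v\<bar> \<or> v = 0"
    using s(3,4) mult_strict_left_mono[of b 1 "\<bar>v\<bar>"] by (auto simp: abs_mult)
  moreover have "\<bar>v\<bar> \<le> \<bar>c - 1\<bar>" using s(7,10,11) by (cases "c > 1") auto
  ultimately have vb: "v = 0 \<or> v * b \<noteq> c - 1" by auto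
  have "v = 0"
  proof (cases "a < c * b")
    case True
    then have "v * b = 0 \<or> v * b = c - 1"
      using assms(2) x by (simp add: farey_def slow_def strip_boundary_def b_def)
    then show ?thesis using vb s(3) by auto
  next
    case False
    then have "(1 + v * b) / c - 1 = 0 \<or> (1 + v * b) / c - 1 = 1 / c - 1"
      using assms(2) x by (simp add: farey_def turn_def strip_boundary_def b_def)
    then show ?thesis using vb s(3,6) by (auto simp: field_simps)
  qed
  then show ?thesis by (simp add: x strip_boundary_def push_def push_base_def Let_def)
qed

section \<open>Contraction in the stable cone\<close>

text \<open>
  With \<open>X = F'(0) = c + a v\<close> and \<open>Y = (a + 1 + v - c) / a\<close>, the length \<open>|dv| / X\<close> for \<open>c > 1\<close>
  and \<open>|dv| / Y\<close> for \<open>c < 1\<close> never increases on the stable cone. Slow steps preserve \<open>X\<close>,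
  and after a turn the new \<open>Y\<close> is \<open>X / c\<close>.
\<close>

definition weight :: "state \<Rightarrow> real" where
  "weight = (\<lambda>(c, a, v). if c > 1 then c + a * v else (a + 1 + v - c) / a)"

lemma contraction_bounds:
  assumes "(c, a, v) \<in> states" "b = gap c (a, v)" "0 \<le> k" "k \<le> b"
  shows "0 < b + v * k" "b + v * k \<le> (if c > 1 then b * (1 + v) else b)"
proof -
  note s = state_bounds[OF assms(1,2)]
  have "0 < b + v * k \<and> b + v * k \<le> (if c > 1 then b * (1 + v) else b)"
  proof (cases "c > 1")
    case True
    then have "0 \<le> v * k" "v * k \<le> v * b"
      using s(10) assms by (auto intro: mult_left_mono)
    then show ?thesis using True s(3) by (simp add: algebra_simps)
  next
    case False
    then have v: "v \<le> 0" using s(7,11) by simp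
    then have "v * k \<le> 0" "v * b \<le> v * k"
      using assms by (auto simp: mult_nonpos_nonneg intro: mult_left_mono_neg)
    moreover have "0 < b * (1 + v)" using s by simp
    ultimately show ?thesis using False by (simp add: algebra_simps)
  qed
  then show "0 < b + v * k" "b + v * k \<le> (if c > 1 then b * (1 + v) else b)" by auto
qed

lemma contraction_pos:
  assumes "(c, a, v) \<in> states" "0 \<le> k" "k \<le> gap c (a, v)"
  shows "0 < contraction (c, a, v) k"
  using contraction_bounds(1)[OF assms(1) refl assms(2,3)] state_bounds(5,6)[OF assms(1) refl]
  by (simp add: contraction_def Let_def)

lemma contraction_slow:
  assumes "(c, a, v) \<in> states" "0 \<le> k" "k \<le> gap c (a, v)" "a < c * gap c (a, v)"
  shows "contraction (c, a, v) k * weight (c, a, v) \<le> weight (farey (c, a, v))"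
proof -
  define b where "b = gap c (a, v)"
  note s = state_bounds[OF assms(1) b_def]
  note d = contraction_bounds[OF assms(1) b_def assms(2) assms(3)[folded b_def]]
  have f: "farey (c, a, v) = (c, a / b, v * b)" and con: "contraction (c, a, v) k = (b + v * k) / (1 + v)"
    using assms(4) by (simp_all add: farey_def slow_def b_def contraction_def Let_def)
  show ?thesis
  proof (cases "c > 1")
    case True
    then have "b + v * k \<le> b * (1 + v)" using d by simp
    also have "\<dots> \<le> 1 * (1 + v)" using s(4,5) by (intro mult_right_mono) auto
    finally have "(b + v * k) / (1 + v) \<le> 1" using s(5) by simp
    moreover have "0 \<le> (b + v * k) / (1 + v)" using d(1) s(5) by simp
    moreover have "weight (c, a, v) = c + a * v" "weight (farey (c, a, v)) = c + a * v"
      using True s(3) unfolding f by (simp_all add: weight_def)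
    ultimately show ?thesis
      using mult_left_le_one_le[of "c + a * v" "(b + v * k) / (1 + v)"] s(9) unfolding con by simp
  next
    case False
    then have W: "weight (c, a, v) = (1 - b) * (1 + v) / a"
      using s(8) by (simp add: weight_def) (simp add: algebra_simps)
    have "a / b + 1 + v * b - c = (a + b) * (1 - b) / b"
      unfolding s(8) using s(3) by (simp add: field_simps)
    then have W': "weight (farey (c, a, v)) = (a + b) * (1 - b) / a"
      using False s(3) unfolding f by (simp add: weight_def)
    have "contraction (c, a, v) k * weight (c, a, v) = (b + v * k) * (1 - b) / a"
      unfolding con W using s(5) by simp
    also have "\<dots> \<le> (a + b) * (1 - b) / a"
      using d(2) False s(1,4) by (intro divide_right_mono mult_right_mono) auto
    finally show ?thesis unfolding W' .
  qed
qed

text \<open>For \<open>c > 1\<close> the gain is the bound \<open>b \<le> c / (1 + c)\<close>. For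
  \<open>c < 1\<close> only \<open>b + v * k \<le> a + b\<close> is used, which gives no strict
  factor.\<close>

lemma contraction_turn:
  assumes "(c, a, v) \<in> states" "0 \<le> k" "k \<le> gap c (a, v)" "c * gap c (a, v) < a" "c \<le> C" "1 / c \<le> C"
  shows "contraction (c, a, v) k * weight (c, a, v) \<le>
      (if c > 1 then C / (1 + C) else 1) * weight (farey (c, a, v))"
    and "weight (farey (c, a, v)) \<le> C\<^sup>2"
proof -
  define b where "b = gap c (a, v)"
  note s = state_bounds[OF assms(1) b_def]
  note d = contraction_bounds[OF assms(1) b_def assms(2) assms(3)[folded b_def]]
  have f: "farey (c, a, v) = (1 / c, b / a, (1 + v * b) / c - 1)"
    and con: "contraction (c, a, v) k = (b + v * k) / ((1 + v) * c)"
    using assms(4) by (simp_all add: farey_def turn_def b_def contraction_def Let_def)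
  have "contraction (c, a, v) k * weight (c, a, v) \<le>
      (if c > 1 then C / (1 + C) else 1) * weight (farey (c, a, v)) \<and> weight (farey (c, a, v)) \<le> C\<^sup>2"
  proof (cases "c > 1")
    case True
    then have "\<not> 1 / c > 1" by simp
    then have W': "weight (farey (c, a, v)) = (c + a * v) / c"
      using s(1,3,6) unfolding f by (simp add: weight_def field_simps)
    have "(b + v * k) / (1 + v) \<le> b" using d(2) True s(5) by (simp add: divide_le_eq)
    also have "\<dots> \<le> c / (1 + c)" using gap_turn_bound[OF assms(1) b_def _ True] assms(4) b_def by simp
    also have "c * (1 + C) \<le> C * (1 + c)" using assms(5) by (simp add: algebra_simps)
    then have "c / (1 + c) \<le> C / (1 + C)" using assms(5) s(6) by (simp add: divide_simps)
    finally have "(b + v * k) / (1 + v) * ((c + a * v) / c) \<le> C / (1 + C) * ((c + a * v) / c)"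
      using s(6,9) by (intro mult_right_mono) auto
    moreover have "contraction (c, a, v) k * weight (c, a, v) = (b + v * k) / (1 + v) * ((c + a * v) / c)"
      using True unfolding con by (simp add: weight_def)
    moreover have "(c + a * v) / c \<le> C\<^sup>2"
    proof -
      have "a * v \<le> c * (c - 1)" using s(1,2,10) True by (intro mult_mono) auto
      then have "(c + a * v) / c \<le> c" using s(6) by (simp add: divide_le_eq algebra_simps)
      also have "c \<le> C * C" using assms(5) True mult_mono[of 1 C c C] by simp
      finally show ?thesis by (simp add: power2_eq_square)
    qed
    ultimately show ?thesis using True W' by simp
  next
    case False
    then have c: "c < 1" "1 / c > 1" using s(6,7) by auto
    have W: "weight (c, a, v) = (1 - b) * (1 + v) / a"
      using False s(8) by (simp add: weight_def) (simp add: algebra_simps)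
    have "a + b * (1 + v * b - c) = (a + b) * (1 - b)"
      unfolding s(8) by (simp add: algebra_simps)
    then have "(a + b) * (1 - b) / (a * c) = (a + b * (1 + v * b - c)) / (a * c)" by simp
    also have "\<dots> = 1 / c + b / a * ((1 + v * b) / c - 1)"
      using s(1,6) by (simp add: field_simps)
    finally have W': "weight (farey (c, a, v)) = (a + b) * (1 - b) / (a * c)"
      using c unfolding f by (simp add: weight_def)
    have "contraction (c, a, v) k * weight (c, a, v) = (b + v * k) * (1 - b) / (a * c)"
      unfolding con W using s(5) by simp
    also have "\<dots> \<le> (a + b) * (1 - b) / (a * c)"
      using d(2) False s(1,4,6) by (intro divide_right_mono mult_right_mono) auto
    finally have 1: "contraction (c, a, v) k * weight (c, a, v) \<le> weight (farey (c, a, v))"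
      unfolding W' .
    have "(1 / c, b / a, (1 + v * b) / c - 1) \<in> states"
      using farey_states[OF assms(1)] unfolding f .
    note s' = state_bounds[OF this refl]
    \<comment> \<open>The image has parameter \<open>1 / c > 1\<close>, and there the weight is
      bounded by the strip conditions \<open>a' < 1 / c\<close> and
      \<open>v' \<le> 1 / c - 1\<close>.\<close>
    have "b / a * ((1 + v * b) / c - 1) \<le> 1 / c * (1 / c - 1)"
      using s'(1,2,10) s(6) c by (intro mult_mono) auto
    then have "weight (farey (c, a, v)) \<le> 1 / c + 1 / c * (1 / c - 1)"
      using c unfolding f by (simp add: weight_def)
    also have "\<dots> = (1 / c)\<^sup>2" by (simp add: power2_eq_square algebra_simps)
    also have "\<dots> \<le> C\<^sup>2" using assms(6) s(6) by (intro power_mono) auto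
    finally show ?thesis using 1 False by simp
  qed
  then show "contraction (c, a, v) k * weight (c, a, v) \<le>
      (if c > 1 then C / (1 + C) else 1) * weight (farey (c, a, v))"
    "weight (farey (c, a, v)) \<le> C\<^sup>2" by auto
qed

lemma weight_ge_one:
  assumes "x \<in> states"
  shows "1 \<le> weight x"
proof -
  obtain c a v where x: "x = (c, a, v)" by (cases x)
  note s = state_bounds[OF assms[unfolded x] refl]
  show ?thesis
  proof (cases "c > 1")
    case True
    then have "0 \<le> a * v" using s(1,10) by simp
    then show ?thesis using True by (simp add: x weight_def)
  next
    case False
    then show ?thesis using s(1,7,11) by (simp add: x weight_def)
  qed
qed

section \<open>Hyperbolicity\<close>

text \<open>An infinite height somewhere would make the rotation number rational, while the
  prescribed one is irrational.\<close>

lemma attractor_inf_renorm: "attractor c \<subseteq> inf_renorm c"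
proof
  fix p assume "p \<in> attractor c"
  then obtain r where r: "\<And>i. 1 \<le> r i" "p \<in> strip c"
      "rotation_number c p = cf_value (\<lambda>i. enat (r (int i)))"
    by (auto simp: attractor_def attractor_point_def)
  have "rotation_number c p \<notin> \<rat>"
    unfolding r(3) using r(1) by (intro cf_value_irrational[of "\<lambda>i. r (int i)"]) auto
  then have "heights c p n \<noteq> \<infinity>" for n
    using cf_value_rat unfolding rotation_number_def by blast
  then show "p \<in> inf_renorm c" using r(2) by (simp add: inf_renorm_def)
qed

lemma linear_image_line:
  fixes A :: "'a::real_vector \<Rightarrow> 'b::real_vector"
  assumes "linear A" "A u = k *\<^sub>R u'" "k \<noteq> 0"
  shows "A ` span {u} = span {u'}"
proof -
  have "A ` span {u} = span {k *\<^sub>R u'}"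
    using linear_span_image[OF assms(1), of "{u}"] assms(2) by simp
  also have "\<dots> = span {u'}"
  proof (rule span_eq[THEN iffD2], intro conjI)
    show "{k *\<^sub>R u'} \<subseteq> span {u'}" by (simp add: span_base span_scale)
    have "(1 / k) *\<^sub>R (k *\<^sub>R u') \<in> span {k *\<^sub>R u'}" by (intro span_scale span_base) simp
    then show "{u'} \<subseteq> span {k *\<^sub>R u'}" using assms(3) by simp
  qed
  finally show ?thesis .
qed

lemma is_splitting_lines:
  fixes u w :: "real \<times> real"
  assumes "fst u * snd w - snd u * fst w \<noteq> 0" (is "?d \<noteq> 0")
  shows "is_splitting (span {u}) (span {w})"
proof -
  \<comment> \<open>Cramer's rule.\<close>
  have "h = (((fst h * snd w - snd h * fst w) / ?d) *\<^sub>R u + ((fst u * snd h - snd u * fst h) / ?d) *\<^sub>R w)"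
    for h
    using assms by (simp add: prod_eq_iff add_divide_distrib[symmetric] eq_divide_eq) (simp add: algebra_simps)
  moreover have "r *\<^sub>R u \<in> span {u}" "r *\<^sub>R w \<in> span {w}" for r
    by (auto intro: span_scale span_base)
  ultimately have "h \<in> {u' + w' | u' w'. u' \<in> span {u} \<and> w' \<in> span {w}}" for h
    by blast
  then have "{u' + w' | u' w'. u' \<in> span {u} \<and> w' \<in> span {w}} = UNIV"
    by blast
  moreover have "x = 0" if x: "x \<in> span {u}" "x \<in> span {w}" for x
  proof -
    obtain s where "x = s *\<^sub>R u" using x(1) by (auto simp: span_singleton)
    moreover obtain t where "x = t *\<^sub>R w" using x(2) by (auto simp: span_singleton)
    ultimately have "s * fst u = t * fst w" "s * snd u = t * snd w"
      by (metis fst_scaleR real_scaleR_def) (metis \<open>x = s *\<^sub>R u\<close> \<open>x = t *\<^sub>R w\<close> snd_scaleR real_scaleR_def)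
    then have "(s * fst u) * snd w - (s * snd u) * fst w = 0" by simp
    then have "s * ?d = 0" by (simp add: algebra_simps)
    then show "x = 0" using assms \<open>x = s *\<^sub>R u\<close> by simp
  qed
  ultimately show ?thesis
    by (auto simp: is_splitting_def span_zero)
qed

section \<open>Expansion and contraction along the invariant line fields\<close>

definition udir :: "(state \<Rightarrow> real) \<Rightarrow> state \<Rightarrow> real \<times> real" where
  "udir f = (\<lambda>(c, p). uvec c (fst p) (f (c, p)))"

definition wdir :: "(state \<Rightarrow> real) \<Rightarrow> state \<Rightarrow> real \<times> real" where
  "wdir g x = wvec (tilt x (g x))"

lemma unit_range:
  assumes "range f \<subseteq> {0..1::real}"
  shows "0 \<le> f x" "f x \<le> 1"
  using subsetD[OF assms rangeI[of f x]] by auto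

lemma norm_wdir: "1 \<le> norm (wdir g x)" "x \<in> states \<Longrightarrow> range g \<subseteq> {0..1} \<Longrightarrow> norm (wdir g x) \<le> 2"
proof -
  show "1 \<le> norm (wdir g x)"
    using norm_snd_le[of "1::real" "- tilt x (g x)"] by (simp add: wdir_def wvec_def)
  assume "x \<in> states" "range g \<subseteq> {0..1}"
  then have "\<bar>tilt x (g x)\<bar> \<le> 1"
    using tilt_range(1,2)[of x "g x"] unit_range[of g x] by auto
  then show "norm (wdir g x) \<le> 2"
    using norm_Pair_le[of "- tilt x (g x)" "1::real"] by (simp add: wdir_def wvec_def)
qed

text \<open>The lower bound is \<open>a\<close>, which may be small; the second estimate of
  \<open>growth_turn\<close> makes up for it.\<close>

lemma norm_udir:
  assumes "(c, p) \<in> states" "range f \<subseteq> {0..1}"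
  shows "fst p \<le> norm (udir f (c, p))" "c \<le> C \<Longrightarrow> 1 / c \<le> C \<Longrightarrow> norm (udir f (c, p)) \<le> 2 * C"
proof -
  obtain a v where p: "p = (a, v)" by (cases p)
  note s = state_bounds[OF assms(1)[unfolded p] refl]
  note q = unit_range[OF assms(2), of "(c, a, v)"]
  show "fst p \<le> norm (udir f (c, p))"
    using norm_fst_le[of a "if c > 1 then - (a * f (c, a, v)) else f (c, a, v)"] s(1)
    by (auto simp: udir_def uvec_def p split: if_splits)
  assume C: "c \<le> C" "1 / c \<le> C"
  have af: "0 \<le> a * f (c, a, v)" "a * f (c, a, v) \<le> a" using s(1) q by (auto simp: mult_left_le)
  have "\<bar>a\<bar> + \<bar>if c > 1 then - (a * f (c, a, v)) else f (c, a, v)\<bar> \<le> 2 * C"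
  proof (cases "c > 1")
    case True
    then have "\<bar>if c > 1 then - (a * f (c, a, v)) else f (c, a, v)\<bar> = a * f (c, a, v)"
      using abs_of_nonneg[OF af(1)] by simp
    then show ?thesis using af(2) s(1,2) C(1) by linarith
  next
    case False
    then have "1 < C" using s(6,7) C(2) less_le_trans[of 1 "1 / c" C] by simp
    then show ?thesis using False s(1,2) q C(1) by simp
  qed
  then show "norm (udir f (c, p)) \<le> 2 * C"
    using norm_Pair_le[of a "if c > 1 then - (a * f (c, a, v)) else f (c, a, v)"]
    by (auto simp: udir_def uvec_def p split: if_splits)
qed

text \<open>With \<open>q = f x\<close> and \<open>k = tilt x (g x)\<close>, the determinant is
  \<open>a * (1 - q * k)\<close> or \<open>a + q * k\<close>; it is positive because
  \<open>k \<le> b < 1\<close>.\<close>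

lemma splitting_dirs:
  assumes "x \<in> states" "range f \<subseteq> {0..1}" "range g \<subseteq> {0..1}"
  shows "is_splitting (span {udir f x}) (span {wdir g x})"
proof (rule is_splitting_lines)
  obtain c a v where x: "x = (c, a, v)" by (cases x)
  note s = state_bounds[OF assms(1)[unfolded x] refl]
  note q = unit_range[OF assms(2), of x]
  have K: "0 \<le> tilt x (g x)" "tilt x (g x) < 1"
    using tilt_range[OF assms(1) unit_range[OF assms(3), of x]] x s(4) by (auto intro: le_less_trans)
  then have "f x * tilt x (g x) < 1"
    using q mult_left_le_one_le[of "tilt x (g x)" "f x"] by simp
  then have "a * (f x * tilt x (g x)) < a * 1" using s(1) by (intro mult_strict_left_mono) auto
  moreover have "0 \<le> f x * tilt x (g x)" using q K by simp
  ultimately show "fst (udir f x) * snd (wdir g x) - snd (udir f x) * fst (wdir g x) \<noteq> 0"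
    using s(1) by (auto simp: udir_def wdir_def x uvec_def wvec_def mult.assoc)
qed

text \<open>\<mu> bounds the expansion of \<open>|da| / a\<close>, \<delta> that of
  \<open>|da|\<close> for a start with \<open>|da| = a\<close>, and \<nu> the contraction of the
  weighted \<open>|dv|\<close>.\<close>

definition hyperbolic_step ::
    "(state \<Rightarrow> real) \<Rightarrow> (state \<Rightarrow> real) \<Rightarrow> (real \<times> real \<Rightarrow> real \<times> real) \<Rightarrow> state \<Rightarrow> state \<Rightarrow>
      real \<Rightarrow> real \<Rightarrow> real \<Rightarrow> bool" where
  "hyperbolic_step f g A x y \<mu> \<delta> \<nu> \<longleftrightarrow>
     (\<exists>\<rho>. A (udir f x) = \<rho> *\<^sub>R udir f y \<and> \<mu> \<le> \<bar>\<rho>\<bar> \<and> \<delta> \<le> \<bar>\<rho>\<bar> * fst (snd y)) \<and>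
     (\<exists>\<theta>>0. A (wdir g x) = \<theta> *\<^sub>R wdir g y \<and> \<theta> * weight x \<le> \<nu> * weight y)"

lemma hyperbolic_step_mono:
  assumes "hyperbolic_step f g A x y \<mu>' \<delta>' \<nu>" "\<mu> \<le> \<mu>'" "\<delta> \<le> \<delta>'"
  shows "hyperbolic_step f g A x y \<mu> \<delta> \<nu>"
  using assms unfolding hyperbolic_step_def by (blast intro: order_trans)

text \<open>Only the last step contributes its \<delta>, as \<delta> involves the \<open>a\<close>
  of the endpoint; a slow step may thus come first with \<delta> equal to 0.\<close>

lemma hyperbolic_step_compose:
  assumes "hyperbolic_step f g A x y \<mu> \<delta> \<nu>" "hyperbolic_step f g B y z \<mu>' \<delta>' \<nu>'"
    and "linear B" "0 \<le> \<mu>" "0 \<le> \<mu>'" "0 \<le> \<delta>'" "0 \<le> \<nu>" "y \<in> states"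
  shows "hyperbolic_step f g (B \<circ> A) x z (\<mu> * \<mu>') (\<mu> * \<delta>') (\<nu> * \<nu>')"
proof -
  obtain \<rho> \<theta> where 1: "A (udir f x) = \<rho> *\<^sub>R udir f y" "\<mu> \<le> \<bar>\<rho>\<bar>"
      "0 < \<theta>" "A (wdir g x) = \<theta> *\<^sub>R wdir g y" "\<theta> * weight x \<le> \<nu> * weight y"
    using assms(1) by (auto simp: hyperbolic_step_def)
  obtain \<rho>' \<theta>' where 2: "B (udir f y) = \<rho>' *\<^sub>R udir f z" "\<mu>' \<le> \<bar>\<rho>'\<bar>" "\<delta>' \<le> \<bar>\<rho>'\<bar> * fst (snd z)"
      "0 < \<theta>'" "B (wdir g y) = \<theta>' *\<^sub>R wdir g z" "\<theta>' * weight y \<le> \<nu>' * weight z"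
    using assms(2) by (auto simp: hyperbolic_step_def)
  have "(B \<circ> A) (udir f x) = (\<rho> * \<rho>') *\<^sub>R udir f z"
    "(B \<circ> A) (wdir g x) = (\<theta> * \<theta>') *\<^sub>R wdir g z"
    using 1 2 assms(3) by (simp_all add: linear_cmul)
  moreover have "\<mu> * \<mu>' \<le> \<bar>\<rho> * \<rho>'\<bar>"
    using 1(2) 2(2) assms(4,5) by (simp add: abs_mult mult_mono)
  moreover have "\<mu> * \<delta>' \<le> \<bar>\<rho> * \<rho>'\<bar> * fst (snd z)"
    using mult_mono[OF 1(2) 2(3)] assms(4,6) by (simp add: abs_mult mult.assoc)
  moreover have "(\<theta> * \<theta>') * weight x \<le> (\<nu> * \<nu>') * weight z"
  proof -
    have "(\<theta> * \<theta>') * weight x = \<theta>' * (\<theta> * weight x)" by simp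
    also have "\<dots> \<le> \<theta>' * (\<nu> * weight y)" using 1(5) 2(4) by simp
    also have "\<dots> = \<nu> * (\<theta>' * weight y)" by simp
    also have "\<dots> \<le> \<nu> * (\<nu>' * weight z)" using 2(6) assms(7) by (rule mult_left_mono)
    finally show ?thesis by simp
  qed
  ultimately show ?thesis
    unfolding hyperbolic_step_def using 1(3) 2(4) by (metis mult_pos_pos)
qed

context
  fixes f g :: "state \<Rightarrow> real"
  assumes f_range: "range f \<subseteq> {0..1}" and f_push: "\<And>x. x \<in> states \<Longrightarrow> f (farey x) = push x (f x)"
    and g_range: "range g \<subseteq> {0..1}" and g_pull: "\<And>x. x \<in> states \<Longrightarrow> g x = pull x (g (farey x))"
begin

lemma fg_bounds: "0 \<le> f x" "f x \<le> 1" "0 \<le> g x" "g x \<le> 1"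
  using unit_range[OF f_range] unit_range[OF g_range] by auto

lemma dfarey_udir:
  assumes "(c, a, v) \<in> states"
  shows "dfarey (c, a, v) (udir f (c, a, v)) =
    (if a < c * gap c (a, v) then growth (c, a, v) (f (c, a, v)) else - growth (c, a, v) (f (c, a, v))) *\<^sub>R
      udir f (farey (c, a, v))"
proof -
  obtain c' a' v' where fx: "farey (c, a, v) = (c', a', v')" by (cases "farey (c, a, v)")
  show ?thesis
    using dfarey_uvec[OF assms refl fx fg_bounds(1,2)] f_push[OF assms] by (simp add: udir_def fx)
qed

lemma dfarey_wdir:
  assumes "x \<in> states"
  shows "dfarey x (wdir g x) = contraction x (tilt x (g x)) *\<^sub>R wdir g (farey x)"
  using dfarey_wvec[OF assms fg_bounds(3,4)] g_pull[OF assms] by (simp add: wdir_def)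

lemma hyperbolic_slow:
  assumes "(c, a, v) \<in> states" "a < c * gap c (a, v)"
  shows "hyperbolic_step f g (dslow c (a, v)) (c, a, v) (c, slow c (a, v)) 1 0 1"
proof -
  have fx: "farey (c, a, v) = (c, slow c (a, v))" and d: "dfarey (c, a, v) = dslow c (a, v)"
    using assms(2) by (simp_all add: farey_def dfarey_def)
  note K = tilt_range(1,3)[OF assms(1) fg_bounds(3,4)]
  have "0 \<le> fst (slow c (a, v))"
    using state_bounds[OF assms(1) refl] by (simp add: slow_def)
  moreover have gr: "1 \<le> growth (c, a, v) (f (c, a, v))"
    by (rule growth_ge_one[OF assms(1) fg_bounds(1,2)])
  moreover have "dslow c (a, v) (udir f (c, a, v)) = growth (c, a, v) (f (c, a, v)) *\<^sub>R udir f (c, slow c (a, v))"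
    using dfarey_udir[OF assms(1)] assms(2) unfolding d fx by simp
  ultimately have "\<exists>\<rho>. dslow c (a, v) (udir f (c, a, v)) = \<rho> *\<^sub>R udir f (c, slow c (a, v)) \<and>
      1 \<le> \<bar>\<rho>\<bar> \<and> 0 \<le> \<bar>\<rho>\<bar> * fst (snd (c, slow c (a, v)))"
    by (intro exI[of _ "growth (c, a, v) (f (c, a, v))"]) auto
  moreover have "dslow c (a, v) (wdir g (c, a, v)) =
      contraction (c, a, v) (tilt (c, a, v) (g (c, a, v))) *\<^sub>R wdir g (c, slow c (a, v))"
    using dfarey_wdir[OF assms(1)] unfolding d fx .
  ultimately show ?thesis
    using contraction_pos[OF assms(1) K(1) K(2)[OF refl]]
      contraction_slow[OF assms(1) K(1) K(2)[OF refl] assms(2)]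
    unfolding hyperbolic_step_def fx mult_1_left by blast
qed

lemma hyperbolic_turn:
  assumes "(c, a, v) \<in> states" "c * gap c (a, v) < a" "c \<le> C" "1 / c \<le> C"
  shows "hyperbolic_step f g (dturn c (a, v)) (c, a, v) (1 / c, turn c (a, v))
    (1 + 1 / (1 + C)) (1 / (C * (1 + C))) (if c > 1 then C / (1 + C) else 1)"
proof -
  have fx: "farey (c, a, v) = (1 / c, turn c (a, v))" and d: "dfarey (c, a, v) = dturn c (a, v)"
    using assms(2) by (simp_all add: farey_def dfarey_def)
  note K = tilt_range(1,3)[OF assms(1) fg_bounds(3,4)]
  have gr: "1 \<le> growth (c, a, v) (f (c, a, v))" by (rule growth_ge_one[OF assms(1) fg_bounds(1,2)])
  have "dturn c (a, v) (udir f (c, a, v)) = (- growth (c, a, v) (f (c, a, v))) *\<^sub>R udir f (1 / c, turn c (a, v))"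
    using dfarey_udir[OF assms(1)] assms(2) unfolding d fx by simp
  moreover have "1 + 1 / (1 + C) \<le> \<bar>- growth (c, a, v) (f (c, a, v))\<bar>"
    "1 / (C * (1 + C)) \<le> \<bar>- growth (c, a, v) (f (c, a, v))\<bar> * fst (snd (1 / c, turn c (a, v)))"
    using growth_turn[OF assms(1,2) fg_bounds(1,2) assms(3,4)] gr by (simp_all add: turn_def)
  moreover have "dturn c (a, v) (wdir g (c, a, v)) =
      contraction (c, a, v) (tilt (c, a, v) (g (c, a, v))) *\<^sub>R wdir g (1 / c, turn c (a, v))"
    using dfarey_wdir[OF assms(1)] unfolding d fx .
  ultimately show ?thesis
    using contraction_pos[OF assms(1) K(1) K(2)[OF refl]]
      contraction_turn(1)[OF assms(1) K(1) K(2)[OF refl] assms(2-4)]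
    unfolding hyperbolic_step_def fx by blast
qed

lemma hyperbolic_renorm_orbit:
  assumes "(c, p) \<in> states" "p \<in> slow_times k c" "c \<le> C" "1 / c \<le> C"
  shows "\<exists>A. ((\<lambda>p. turn c ((slow c ^^ k) p)) has_derivative A) (at p) \<and>
    hyperbolic_step f g A (c, p) (1 / c, turn c ((slow c ^^ k) p))
      (1 + 1 / (1 + C)) (1 / (C * (1 + C))) (if c > 1 then C / (1 + C) else 1) \<and>
    weight (1 / c, turn c ((slow c ^^ k) p)) \<le> C\<^sup>2"
  using assms(1,2)
proof (induction k arbitrary: p)
  case 0
  obtain a v where p: "p = (a, v)" by (cases p)
  have st: "(c, a, v) \<in> states" and br: "c * gap c (a, v) < a" and dom: "(a, v) \<in> inner_dom c"
    using 0 p by auto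
  have fx: "farey (c, a, v) = (1 / c, turn c (a, v))" using br by (simp add: farey_def)
  note K = tilt_range(1,3)[OF st fg_bounds(3,4)]
  show ?case
    using hyperbolic_turn[OF st br assms(3,4)] turn_has_derivative[OF dom]
      contraction_turn(2)[OF st K(1) K(2)[OF refl] br assms(3,4)]
    unfolding p fx by auto
next
  case (Suc k)
  obtain a v where p: "p = (a, v)" by (cases p)
  have st: "(c, a, v) \<in> states" and br: "a < c * gap c (a, v)" and dom: "(a, v) \<in> inner_dom c"
    and s: "slow c (a, v) \<in> slow_times k c"
    using Suc.prems p by auto
  have fx: "farey (c, a, v) = (c, slow c (a, v))" using br by (simp add: farey_def)
  have st': "(c, slow c (a, v)) \<in> states" using farey_states[OF st] unfolding fx .
  have c: "0 < c" using state_bounds(6)[OF st refl] .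
  obtain A where A: "((\<lambda>p. turn c ((slow c ^^ k) p)) has_derivative A) (at (slow c (a, v)))"
      "hyperbolic_step f g A (c, slow c (a, v)) (1 / c, turn c ((slow c ^^ k) (slow c (a, v))))
        (1 + 1 / (1 + C)) (1 / (C * (1 + C))) (if c > 1 then C / (1 + C) else 1)"
      "weight (1 / c, turn c ((slow c ^^ k) (slow c (a, v)))) \<le> C\<^sup>2"
    using Suc.IH[OF st' s] by blast
  have "(((\<lambda>p. turn c ((slow c ^^ k) p)) \<circ> slow c) has_derivative (A \<circ> dslow c (a, v))) (at (a, v))"
    by (rule diff_chain_at[OF slow_has_derivative[OF dom] A(1)])
  \<comment> \<open>Prepending a slow step costs nothing: its rates are 1, 0 and 1, so the rates of
    the turn survive for every \<open>k\<close>.\<close>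
  moreover have "hyperbolic_step f g (A \<circ> dslow c (a, v)) (c, a, v)
      (1 / c, turn c ((slow c ^^ k) (slow c (a, v))))
      (1 * (1 + 1 / (1 + C))) (1 * (1 / (C * (1 + C)))) (1 * (if c > 1 then C / (1 + C) else 1))"
    using assms(3) c A(1)
    by (intro hyperbolic_step_compose[OF hyperbolic_slow[OF st br] A(2)] st')
       (auto intro: has_derivative_linear)
  ultimately show ?case
    using A(3) unfolding p by (auto simp: funpow_Suc_right comp_def simp del: funpow.simps)
qed

lemma hyperbolic_renorm:
  assumes "(c, p) \<in> states" "c \<le> C" "1 / c \<le> C"
  shows "\<exists>A. (renorm c has_derivative A) (at p) \<and>
    hyperbolic_step f g A (c, p) (1 / c, renorm c p)
      (1 + 1 / (1 + C)) (1 / (C * (1 + C))) (if c > 1 then C / (1 + C) else 1) \<and>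
    weight (1 / c, renorm c p) \<le> C\<^sup>2"
proof -
  have p: "p \<in> inf_renorm c" using assms(1) by (simp add: states_def)
  obtain k where k: "p \<in> slow_times k c" using inf_renorm_slow_times[OF p] .
  have "(renorm c has_derivative A) (at p)"
    if "((\<lambda>p. turn c ((slow c ^^ k) p)) has_derivative A) (at p)" for A
    using has_derivative_transform_within_open[OF that open_slow_times k] renorm_slow_times by metis
  then show ?thesis
    using hyperbolic_renorm_orbit[OF assms(1) k assms(2,3)] unfolding renorm_slow_times[OF k] by blast
qed

lemma renorm_states: "(c, p) \<in> states \<Longrightarrow> (1 / c, renorm c p) \<in> states"
  using inf_renorm_renorm by (auto simp: states_def)

lemma renorm2_states: "(c, p) \<in> states \<Longrightarrow> (c, renorm2 c p) \<in> states"
  using renorm_states[of c p] renorm_states[of "1 / c" "renorm c p"] by (simp add: renorm2_def)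

lemma hyperbolic_renorm2:
  assumes "(c, p) \<in> states" "c \<le> C" "1 / c \<le> C"
  shows "\<exists>A. (renorm2 c has_derivative A) (at p) \<and>
    hyperbolic_step f g A (c, p) (c, renorm2 c p)
      (1 + 1 / (1 + C)) (1 / (C * (1 + C))) (C / (1 + C)) \<and>
    weight (c, renorm2 c p) \<le> C\<^sup>2"
proof -
  have c: "0 < c" "c \<noteq> 1" using assms(1) by (auto simp: states_def)
  let ?\<mu> = "1 + 1 / (1 + C)" and ?\<delta> = "1 / (C * (1 + C))" and ?\<nu> = "C / (1 + C)"
  have C: "0 < C" using c assms(2) by simp
  note st' = renorm_states[OF assms(1)]
  obtain A where A: "(renorm c has_derivative A) (at p)"
      "hyperbolic_step f g A (c, p) (1 / c, renorm c p) ?\<mu> ?\<delta> (if c > 1 then ?\<nu> else 1)"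
    using hyperbolic_renorm[OF assms] by blast
  obtain B where B: "(renorm (1 / c) has_derivative B) (at (renorm c p))"
      "hyperbolic_step f g B (1 / c, renorm c p) (c, renorm2 c p) ?\<mu> ?\<delta> (if 1 / c > 1 then ?\<nu> else 1)"
      "weight (c, renorm2 c p) \<le> C\<^sup>2"
    using hyperbolic_renorm[OF st', of C] assms(2,3) by (auto simp: renorm2_def)
  have der: "(renorm2 c has_derivative (B \<circ> A)) (at p)"
    unfolding renorm2_def by (rule diff_chain_at[OF A(1) B(1)])
  have "hyperbolic_step f g (B \<circ> A) (c, p) (c, renorm2 c p)
      (?\<mu> * ?\<mu>) (?\<mu> * ?\<delta>) ((if c > 1 then ?\<nu> else 1) * (if 1 / c > 1 then ?\<nu> else 1))"
    using C B(1) by (intro hyperbolic_step_compose[OF A(2) B(2)] st') (auto intro: has_derivative_linear)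
  \<comment> \<open>Exactly one of \<open>c\<close> and \<open>1 / c\<close> exceeds 1. Below, the
    surplus factor \<mu> is dropped to give all rates the form of a single step.\<close>
  moreover have "(if c > 1 then ?\<nu> else 1) * (if 1 / c > 1 then ?\<nu> else 1) = ?\<nu>"
    using c by auto
  ultimately have "hyperbolic_step f g (B \<circ> A) (c, p) (c, renorm2 c p) (?\<mu> * ?\<mu>) (?\<mu> * ?\<delta>) ?\<nu>"
    by simp
  moreover have "?\<mu> \<le> ?\<mu> * ?\<mu>" "?\<delta> \<le> ?\<mu> * ?\<delta>"
    using C mult_right_mono[of 1 ?\<mu> ?\<mu>] mult_right_mono[of 1 ?\<mu> ?\<delta>] by simp_all
  ultimately have "hyperbolic_step f g (B \<circ> A) (c, p) (c, renorm2 c p) ?\<mu> ?\<delta> ?\<nu>"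
    by (rule hyperbolic_step_mono)
  then show ?thesis
    using der B(3) by blast
qed

text \<open>Of the \<open>n + 1\<close> renormalizations, the first \<open>n\<close> contribute
  \<mu> to the Euclidean bound and the last one \<delta>.\<close>

lemma hyperbolic_renorm2_iterate:
  assumes "(c, p) \<in> states" "c \<le> C" "1 / c \<le> C"
  shows "\<exists>A. ((renorm2 c ^^ Suc n) has_derivative A) (at p) \<and>
    hyperbolic_step f g A (c, p) (c, (renorm2 c ^^ Suc n) p)
      ((1 + 1 / (1 + C)) ^ Suc n) ((1 + 1 / (1 + C)) ^ n * (1 / (C * (1 + C)))) ((C / (1 + C)) ^ Suc n) \<and>
    (c, (renorm2 c ^^ Suc n) p) \<in> states \<and> weight (c, (renorm2 c ^^ Suc n) p) \<le> C\<^sup>2"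
  using assms(1)
proof (induction n arbitrary: p)
  case 0
  then show ?case using hyperbolic_renorm2[OF 0 assms(2,3)] renorm2_states[OF 0] by simp
next
  case (Suc n)
  let ?\<mu> = "1 + 1 / (1 + C)" and ?\<delta> = "1 / (C * (1 + C))" and ?\<nu> = "C / (1 + C)"
  have C: "0 < C" using Suc.prems assms(2) by (auto simp: states_def)
  let ?q = "renorm2 c p"
  note st' = renorm2_states[OF Suc.prems]
  have it: "renorm2 c ^^ Suc (Suc n) = renorm2 c ^^ Suc n \<circ> renorm2 c"
    by (rule funpow_Suc_right)
  obtain A where A: "(renorm2 c has_derivative A) (at p)"
      "hyperbolic_step f g A (c, p) (c, ?q) ?\<mu> ?\<delta> ?\<nu>"
    using hyperbolic_renorm2[OF Suc.prems assms(2,3)] by blast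
  obtain B where B: "((renorm2 c ^^ Suc n) has_derivative B) (at ?q)"
      "hyperbolic_step f g B (c, ?q) (c, (renorm2 c ^^ Suc n) ?q) (?\<mu> ^ Suc n) (?\<mu> ^ n * ?\<delta>) (?\<nu> ^ Suc n)"
      "(c, (renorm2 c ^^ Suc n) ?q) \<in> states" "weight (c, (renorm2 c ^^ Suc n) ?q) \<le> C\<^sup>2"
    using Suc.IH[OF st'] by blast
  have it_p: "(renorm2 c ^^ Suc (Suc n)) p = (renorm2 c ^^ Suc n) ?q" unfolding it by (rule o_apply)
  have \<delta>: "?\<mu> ^ Suc n * ?\<delta> = ?\<mu> * (?\<mu> ^ n * ?\<delta>)" by (simp only: power_Suc mult.assoc)
  have "((renorm2 c ^^ Suc (Suc n)) has_derivative (B \<circ> A)) (at p)"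
    unfolding it by (rule diff_chain_at[OF A(1) B(1)])
  moreover have "hyperbolic_step f g (B \<circ> A) (c, p) (c, (renorm2 c ^^ Suc (Suc n)) p)
      (?\<mu> ^ Suc (Suc n)) (?\<mu> ^ Suc n * ?\<delta>) (?\<nu> ^ Suc (Suc n))"
    unfolding it_p \<delta> power_Suc[of _ "Suc n"] using C B(1)
    by (intro hyperbolic_step_compose[OF A(2) B(2)] st') (auto intro: has_derivative_linear)
  ultimately show ?case using B(3,4) unfolding it_p by blast
qed

end

theorem theorem2p2:
  fixes c :: real
  assumes "1 / 2 < c" and "c < 2" and "c \<noteq> 1"
  shows "\<exists>(Eu :: real \<times> real \<Rightarrow> (real \<times> real) set) (Es :: real \<times> real \<Rightarrow> (real \<times> real) set)
            (k\<^sub>0 :: nat) (L :: real).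
           1 \<le> k\<^sub>0 \<and> 1 < L \<and>
           (\<forall>z \<in> attractor c.
              is_splitting (Eu z) (Es z) \<and>
              frechet_derivative (renorm2 c) (at z) ` Eu z = Eu (renorm2 c z) \<and>
              frechet_derivative (renorm2 c) (at z) ` Es z = Es (renorm2 c z) \<and>
              (\<forall>w \<in> Eu z. w \<noteq> 0 \<longrightarrow>
                 norm (frechet_derivative (renorm2 c ^^ k\<^sub>0) (at z) w) > L * norm w) \<and>
              (\<forall>w \<in> Es z. w \<noteq> 0 \<longrightarrow>
                 norm (frechet_derivative (renorm2 c ^^ k\<^sub>0) (at z) w) < inverse L * norm w))"
proof -
  define C where "C = max c (1 / c)"
  let ?\<mu> = "1 + 1 / (1 + C)" and ?\<delta> = "1 / (C * (1 + C))" and ?\<nu> = "C / (1 + C)"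
  have C: "c \<le> C" "1 / c \<le> C" "0 < C" using assms by (auto simp: C_def)
  obtain f where f: "range f \<subseteq> {0..1}" "\<And>x. x \<in> states \<Longrightarrow> f (farey x) = push x (f x)"
    by (rule forward_section[of states push farey strip_boundary])
       (use push_range push_mono farey_collision farey_boundary in blast)+
  obtain g where g: "range g \<subseteq> {0..1}" "\<And>x. x \<in> states \<Longrightarrow> g x = pull x (g (farey x))"
    by (rule backward_section[of states pull farey]) (use pull_range pull_mono in blast)+
  note fg = f g
  have "1 < ?\<mu>" "0 \<le> ?\<nu>" "?\<nu> < 1" "0 < ?\<delta>" using C(3) by auto
  \<comment> \<open>The factor \<open>4 * C\<close> is the norm bound \<open>2 * C\<close> of
    \<open>udir\<close> times the required expansion 2.\<close>
  obtain n1 where n1: "4 * C / ?\<delta> < ?\<mu> ^ n1" using real_arch_pow[OF \<open>1 < ?\<mu>\<close>] by blast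
  \<comment> \<open>Passing from weights to norms costs \<open>C^2\<close> for the weight at the
    endpoint and 2 for the norm of \<open>wdir\<close> there; another 2 gives the rate 1/2.\<close>
  obtain n2 where n2: "?\<nu> ^ n2 < 1 / (4 * C\<^sup>2)"
    using real_arch_pow_inv[OF _ \<open>?\<nu> < 1\<close>, of "1 / (4 * C\<^sup>2)"] C(3) by auto
  define n where "n = n1 + n2"
  have "?\<mu> ^ n1 \<le> ?\<mu> ^ n" using \<open>1 < ?\<mu>\<close> by (intro power_increasing) (auto simp: n_def)
  with n1 have "4 * C / ?\<delta> < ?\<mu> ^ n" by (rule less_le_trans)
  then have mu: "2 * (2 * C) < ?\<mu> ^ n * ?\<delta>"
    unfolding pos_divide_less_eq[OF \<open>0 < ?\<delta>\<close>] by simp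
  have "?\<nu> ^ Suc n \<le> ?\<nu> ^ n2" using \<open>0 \<le> ?\<nu>\<close> \<open>?\<nu> < 1\<close> by (intro power_decreasing) (auto simp: n_def)
  from this n2 have "?\<nu> ^ Suc n < 1 / (4 * C\<^sup>2)" by (rule le_less_trans)
  moreover have "0 < 4 * C\<^sup>2" using C(3) by simp
  ultimately have "?\<nu> ^ Suc n * (4 * C\<^sup>2) < 1" by (simp only: pos_less_divide_eq)
  then have nu: "?\<nu> ^ Suc n * C\<^sup>2 < 1 / 4" by (simp del: power_Suc)
  define Eu where "Eu z = span {udir f (c, z)}" for z
  define Es where "Es z = span {wdir g (c, z)}" for z
  have "is_splitting (Eu z) (Es z) \<and>
      frechet_derivative (renorm2 c) (at z) ` Eu z = Eu (renorm2 c z) \<and>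
      frechet_derivative (renorm2 c) (at z) ` Es z = Es (renorm2 c z) \<and>
      (\<forall>w \<in> Eu z. w \<noteq> 0 \<longrightarrow> norm (frechet_derivative (renorm2 c ^^ Suc n) (at z) w) > 2 * norm w) \<and>
      (\<forall>w \<in> Es z. w \<noteq> 0 \<longrightarrow> norm (frechet_derivative (renorm2 c ^^ Suc n) (at z) w) < inverse 2 * norm w)"
    if z: "z \<in> attractor c" for z
  proof (intro conjI ballI impI)
    have st: "(c, z) \<in> states"
      using z attractor_inf_renorm assms by (auto simp: states_def)
    show "is_splitting (Eu z) (Es z)"
      unfolding Eu_def Es_def by (rule splitting_dirs[OF st f(1) g(1)])
    obtain A where A: "(renorm2 c has_derivative A) (at z)"
        "hyperbolic_step f g A (c, z) (c, renorm2 c z) ?\<mu> ?\<delta> ?\<nu>"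
      using hyperbolic_renorm2[OF fg st C(1,2)] by blast
    have dA: "frechet_derivative (renorm2 c) (at z) = A"
      using frechet_derivative_at[OF A(1)] by simp
    have lA: "linear A" using A(1) by (rule has_derivative_linear)
    obtain \<rho> \<theta> where "A (udir f (c, z)) = \<rho> *\<^sub>R udir f (c, renorm2 c z)" "?\<mu> \<le> \<bar>\<rho>\<bar>"
        "0 < \<theta>" "A (wdir g (c, z)) = \<theta> *\<^sub>R wdir g (c, renorm2 c z)"
      using A(2) by (auto simp: hyperbolic_step_def)
    then show "frechet_derivative (renorm2 c) (at z) ` Eu z = Eu (renorm2 c z)"
      "frechet_derivative (renorm2 c) (at z) ` Es z = Es (renorm2 c z)"
      unfolding dA Eu_def Es_def using \<open>1 < ?\<mu>\<close>
      by (metis abs_zero less_le_trans linear_image_line[OF lA] not_one_less_zero, metis less_irrefl linear_image_line[OF lA])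
    let ?z = "(renorm2 c ^^ Suc n) z"
    obtain B where B: "((renorm2 c ^^ Suc n) has_derivative B) (at z)"
        "hyperbolic_step f g B (c, z) (c, ?z) (?\<mu> ^ Suc n) (?\<mu> ^ n * ?\<delta>) (?\<nu> ^ Suc n)"
        "(c, ?z) \<in> states" "weight (c, ?z) \<le> C\<^sup>2"
      using hyperbolic_renorm2_iterate[OF fg st C(1,2)] by blast
    have dB: "frechet_derivative (renorm2 c ^^ Suc n) (at z) = B"
      using frechet_derivative_at[OF B(1)] by simp
    have lB: "linear B" using B(1) by (rule has_derivative_linear)
    fix w :: "real \<times> real" assume "w \<noteq> 0"
    {
      assume "w \<in> Eu z"
      then obtain t where w: "w = t *\<^sub>R udir f (c, z)" by (auto simp: Eu_def span_singleton)
      obtain \<rho> where \<rho>: "B (udir f (c, z)) = \<rho> *\<^sub>R udir f (c, ?z)" "?\<mu> ^ n * ?\<delta> \<le> \<bar>\<rho>\<bar> * fst ?z"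
        using B(2) by (auto simp: hyperbolic_step_def)
      have t: "0 < \<bar>t\<bar>" using \<open>w \<noteq> 0\<close> w by auto
      have "2 * norm w = \<bar>t\<bar> * (2 * norm (udir f (c, z)))" by (simp add: w)
      also have "\<dots> \<le> \<bar>t\<bar> * (2 * (2 * C))"
        using norm_udir(2)[OF st f(1) C(1,2)] by (intro mult_left_mono) auto
      also have "\<dots> < \<bar>t\<bar> * (\<bar>\<rho>\<bar> * fst ?z)"
        using mu \<rho>(2) t by (intro mult_strict_left_mono) auto
      also have "\<dots> \<le> \<bar>t\<bar> * (\<bar>\<rho>\<bar> * norm (udir f (c, ?z)))"
        using norm_udir(1)[OF B(3) f(1)] by (intro mult_left_mono) auto
      also have "\<dots> = norm (B w)"
        unfolding w linear_cmul[OF lB] \<rho>(1) by (simp add: abs_mult)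
      finally show "norm (frechet_derivative (renorm2 c ^^ Suc n) (at z) w) > 2 * norm w"
        unfolding dB .
    next
      assume "w \<in> Es z"
      then obtain t where w: "w = t *\<^sub>R wdir g (c, z)" by (auto simp: Es_def span_singleton)
      obtain \<theta> where \<theta>: "0 < \<theta>" "B (wdir g (c, z)) = \<theta> *\<^sub>R wdir g (c, ?z)"
          "\<theta> * weight (c, z) \<le> ?\<nu> ^ Suc n * weight (c, ?z)"
        using B(2) by (auto simp: hyperbolic_step_def)
      have t: "0 < \<bar>t\<bar>" using \<open>w \<noteq> 0\<close> w by auto
      have "\<theta> * 1 \<le> \<theta> * weight (c, z)" using weight_ge_one[OF st] \<theta>(1) by (intro mult_left_mono) auto
      also note \<theta>(3)
      also have "?\<nu> ^ Suc n * weight (c, ?z) \<le> ?\<nu> ^ Suc n * C\<^sup>2"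
        by (rule mult_left_mono[OF B(4) zero_le_power[OF \<open>0 \<le> ?\<nu>\<close>]])
      finally have "\<theta> * 1 \<le> ?\<nu> ^ Suc n * C\<^sup>2" .
      from this nu have th: "\<theta> * 1 < 1 / 4" by (rule le_less_trans)
      have "norm (B w) = \<bar>t\<bar> * (\<theta> * norm (wdir g (c, ?z)))"
        unfolding w linear_cmul[OF lB] \<theta>(2) using \<theta>(1) by (simp add: abs_mult)
      also have "\<dots> \<le> \<bar>t\<bar> * (\<theta> * 2)"
        using norm_wdir(2)[OF B(3) g(1)] \<theta>(1) by (intro mult_left_mono) auto
      also have "\<dots> < \<bar>t\<bar> * (inverse 2 * 1)"
        using th t by (intro mult_strict_left_mono) auto
      also have "\<dots> \<le> \<bar>t\<bar> * (inverse 2 * norm (wdir g (c, z)))"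
        using norm_wdir(1)[of g "(c, z)"] by (intro mult_left_mono) auto
      also have "\<dots> = inverse 2 * norm w" by (simp add: w)
      finally show "norm (frechet_derivative (renorm2 c ^^ Suc n) (at z) w) < inverse 2 * norm w"
        unfolding dB .
    }
  qed
  then show ?thesis
    by (intro exI[of _ Eu] exI[of _ Es] exI[of _ "Suc n"] exI[of _ 2]) (simp del: funpow.simps)
qed

end
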